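(* Let $H_n$ be the number of distinct binary trees (as binary trees, i.e. with left/right positions distinguished) occurring among the fringe subtrees of a random binary search tree of size $n$. For $c_5=4\sum_{k\ge1}\frac{\log k}{(k+1)(k+2)}\approx2.4071298335$ and $c_6=4\log2\approx2.7725887222$: (i) $c_5\frac{n}{\log n}(1+o(1))\le\mathbb{E}(H_n)\le c_6\frac{n}{\log n}(1+o(1))$; (ii) with probability tending to $1$, $c_5\frac{n}{\log n}(1+o(1))\le H_n\le c_6\frac{n}{\log n}(1+o(1))$.
   Context: A random binary search tree of size $n$ is the binary tree obtained by inserting the keys $1,\dots,n$ in the order of a uniformly random permutation. A fringe subtree is a vertex together with all its descendants. *)

theory Defs
  imports "HOL-Probability.Probability" "HOL-Combinatorics.Multiset_Permutations" "HOL-Library.Tree"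
    "HOL-Real_Asymp.Real_Asymp"
begin

fun bst_insert :: "'a::linorder \<Rightarrow> 'a tree \<Rightarrow> 'a tree" where
  "bst_insert x Leaf = Node Leaf x Leaf"
| "bst_insert x (Node l a r) =
     (if x < a then Node (bst_insert x l) a r
      else if x > a then Node l a (bst_insert x r)
      else Node l a r)"

definition bst_of_list :: "'a::linorder list \<Rightarrow> 'a tree" where
  "bst_of_list xs = fold bst_insert xs Leaf"

definition random_bst :: "nat \<Rightarrow> nat tree pmf" where
  "random_bst n = map_pmf bst_of_list (pmf_of_set (permutations_of_set {1..n}))"

text \<open>The vertices of a tree are its \<^const>\<open>Node\<close>s; \<^const>\<open>Leaf\<close> is the empty tree,
  which \<^const>\<open>subtrees\<close> includes but which is not a fringe subtree.\<close>

definition fringe_subtrees :: "'a tree \<Rightarrow> 'a tree set" where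
  "fringe_subtrees t = subtrees t - {Leaf}"

text \<open>Two fringe subtrees are the same binary tree iff they agree after their keys are erased.\<close>

definition shape :: "'a tree \<Rightarrow> unit tree" where
  "shape t = map_tree (\<lambda>_. ()) t"

definition num_distinct_fringe :: "'a tree \<Rightarrow> nat" where
  "num_distinct_fringe t = card (shape ` fringe_subtrees t)"

definition c5 :: real where
  "c5 = 4 * (\<Sum>k. ln (real (Suc k)) / ((real (Suc k) + 1) * (real (Suc k) + 2)))"

definition c6 :: real where
  "c6 = 4 * ln 2"

lemma summable_c5:
  "summable (\<lambda>k. ln (real (Suc k)) / ((real (Suc k) + 1) * (real (Suc k) + 2)))"
proof (rule summable_comparison_test_bigo)
  show "summable (\<lambda>k. norm (real k powr (-3/2)))"
    by (simp add: summable_real_powr_iff)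
  show "(\<lambda>k. ln (real (Suc k)) / ((real (Suc k) + 1) * (real (Suc k) + 2)))
          \<in> O(\<lambda>k. real k powr (-3/2))"
    by real_asymp
qed

end

theory Submission
  imports Defs
begin

text \<open>
  The shape of a random binary search tree is a tree \<open>t\<close> with probability \<open>\<Prod>\<^sub>v 1/|t\<^sub>v|\<close>
  (\<open>wt t\<close>), the product ranging over the fringe subtrees. For a toll \<open>f\<close> with \<open>0 \<le> f \<le> F\<close> put
  \<open>\<alpha> = 2 \<Sum>\<^sub>k f(k)/((k+1)(k+2))\<close>; then \<open>X(t) = \<Sum>\<^sub>v f(|t\<^sub>v|) - \<alpha>(|t|+1)\<close> satisfies
  \<open>X(t) = f(|t|) + X(l) + X(r)\<close>, and this recurrence gives \<open>|E X| \<le> 2F\<close> and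
  \<open>E X\<^sup>2 \<le> 13F\<^sup>2(n+1)\<close>. With \<open>f(k) = [k \<ge> m]\<close> it shows that the number of fringe subtrees of size at
  least \<open>m\<close> is concentrated around \<open>2n/m\<close>.

  Upper bound: there are at most \<open>2\<cdot>4\<^sup>m\<close> trees of size less than \<open>m\<close>. Take \<open>m\<close> slightly below
  \<open>log n / log 4\<close>.

  Lower bound: the truncated toll \<open>f(k) = [k \<le> M] log k\<close> shows that a random tree of size \<open>k\<close> has
  \<open>wt t \<le> exp(-ck)\<close> with high probability, for any \<open>c < c5/2\<close>. Take \<open>m\<close> slightly above \<open>log n / c\<close>.
  Fringe subtrees of size at least \<open>m\<close> violating this bound are rare, and so are pairs of fringe
  subtrees sharing a shape that satisfies it, since those have expected number at most of order
  \<open>n\<^sup>2 \<Sum>\<^sub>k\<^sub>\<ge>\<^sub>m exp(-ck)\<close>. So almost all the roughly \<open>2n/m\<close> fringe subtrees are distinct.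
\<close>

subsection \<open>Expectations over random tree shapes\<close>

definition shapes :: "nat \<Rightarrow> unit tree set" where
  "shapes n = {t. size t = n}"

primrec wt :: "'a tree \<Rightarrow> real" where
  "wt Leaf = 1"
| "wt (Node l a r) = wt l * wt r / real (Suc (size l + size r))"

text \<open>A finite sum over shapes instead of an integral over permutations: recurrences in the
  size become manipulations of sums, and \<open>expectation_random_bst\<close> provides the
  link.\<close>

definition bst_ex :: "nat \<Rightarrow> (unit tree \<Rightarrow> real) \<Rightarrow> real" where
  "bst_ex n \<phi> = (\<Sum>t\<in>shapes n. wt t * \<phi> t)"

lemma shapes_0: "shapes 0 = {Leaf}"
  by (auto simp: shapes_def)

lemma shapes_Suc:
  "shapes (Suc n) = (\<Union>i\<le>n. (\<lambda>(l, r). Node l () r) ` (shapes i \<times> shapes (n - i)))"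
proof (intro set_eqI iffI)
  fix t assume "t \<in> shapes (Suc n)"
  then obtain l r where "t = Node l () r" "size l + size r = n"
    by (cases t) (auto simp: shapes_def)
  thus "t \<in> (\<Union>i\<le>n. (\<lambda>(l, r). Node l () r) ` (shapes i \<times> shapes (n - i)))"
    by (intro UN_I[of "size l"] image_eqI[of _ _ "(l, r)"]) (auto simp: shapes_def)
qed (auto simp: shapes_def)

lemma finite_shapes: "finite (shapes n)"
proof (induction n rule: less_induct)
  case (less n)
  show ?case
  proof (cases n)
    case (Suc m)
    show ?thesis unfolding Suc shapes_Suc using less Suc by auto
  qed (simp add: shapes_0)
qed

lemma wt_pos: "wt t > 0"
  by (induction t) auto

lemma bst_ex_0: "bst_ex 0 \<phi> = \<phi> Leaf"
  by (simp add: bst_ex_def shapes_0)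

text \<open>At the root, \<open>wt\<close> is the product of the subtree weights divided by
  \<open>Suc n\<close>: the left size is uniform on \<open>{0..n}\<close> and, given it, the two
  subtrees are independent.\<close>

lemma bst_ex_Suc:
  "bst_ex (Suc n) \<phi> =
     (\<Sum>i\<le>n. bst_ex i (\<lambda>l. bst_ex (n - i) (\<lambda>r. \<phi> (Node l () r)))) / real (Suc n)"
proof -
  let ?N = "\<lambda>(l, r). Node l () r"
  have inj: "inj_on ?N A" for A by (auto simp: inj_on_def)
  have fin: "finite (shapes i \<times> shapes j)" for i j by (simp add: finite_shapes)
  have "bst_ex (Suc n) \<phi> = (\<Sum>i\<le>n. \<Sum>t\<in>?N ` (shapes i \<times> shapes (n - i)). wt t * \<phi> t)"
    unfolding bst_ex_def shapes_Suc
    by (rule sum.UNION_disjoint) (use fin in \<open>auto simp: shapes_def\<close>)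
  also have "\<dots> = (\<Sum>i\<le>n. \<Sum>(l, r)\<in>shapes i \<times> shapes (n - i).
                     wt l * wt r / real (Suc n) * \<phi> (Node l () r))"
    by (intro sum.cong refl, subst sum.reindex[OF inj]) (auto intro!: sum.cong simp: shapes_def)
  also have "\<dots> = (\<Sum>i\<le>n. bst_ex i (\<lambda>l. bst_ex (n - i) (\<lambda>r. \<phi> (Node l () r)))) / real (Suc n)"
    unfolding bst_ex_def sum_divide_distrib sum_distrib_left
    by (intro sum.cong refl, subst sum.cartesian_product [symmetric]) (simp add: mult_ac)
  finally show ?thesis .
qed

lemma bst_ex_cong: "(\<And>t. size t = n \<Longrightarrow> \<phi> t = \<psi> t) \<Longrightarrow> bst_ex n \<phi> = bst_ex n \<psi>"
  by (auto simp: bst_ex_def shapes_def intro!: sum.cong)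

lemma bst_ex_add: "bst_ex n (\<lambda>t. \<phi> t + \<psi> t) = bst_ex n \<phi> + bst_ex n \<psi>"
  by (simp add: bst_ex_def ring_distribs sum.distrib)

lemma bst_ex_cmult: "bst_ex n (\<lambda>t. c * \<phi> t) = c * bst_ex n \<phi>"
  unfolding bst_ex_def sum_distrib_left by (intro sum.cong) simp_all

lemma bst_ex_multc: "bst_ex n (\<lambda>t. \<phi> t * c) = bst_ex n \<phi> * c"
  unfolding bst_ex_def sum_distrib_right by (intro sum.cong) simp_all

lemma bst_ex_sum: "bst_ex n (\<lambda>t. \<Sum>x\<in>A. \<phi> x t) = (\<Sum>x\<in>A. bst_ex n (\<phi> x))"
  by (simp add: bst_ex_def sum_distrib_left) (rule sum.swap)

lemma bst_ex_mono:
  "(\<And>t. size t = n \<Longrightarrow> \<phi> t \<le> \<psi> t) \<Longrightarrow> bst_ex n \<phi> \<le> bst_ex n \<psi>"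
  by (auto simp: bst_ex_def shapes_def intro!: sum_mono mult_left_mono less_imp_le[OF wt_pos])

lemma bst_ex_1: "bst_ex n (\<lambda>_. 1) = 1"
proof (induction n rule: less_induct)
  case (less n)
  thus ?case by (cases n) (simp_all add: bst_ex_0 bst_ex_Suc)
qed

lemma bst_ex_const: "bst_ex n (\<lambda>_. c) = c"
  using bst_ex_cmult[of n c "\<lambda>_. 1"] by (simp add: bst_ex_1)

lemma bst_ex_nonneg: "(\<And>t. size t = n \<Longrightarrow> \<phi> t \<ge> 0) \<Longrightarrow> bst_ex n \<phi> \<ge> 0"
  using bst_ex_mono[of n "\<lambda>_. 0" \<phi>] by (simp add: bst_ex_const)

lemma bst_ex_markov:
  assumes "\<And>t. size t = n \<Longrightarrow> \<phi> t \<ge> 0" "a > 0"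
  shows "bst_ex n (\<lambda>t. of_bool (\<phi> t \<ge> a)) \<le> bst_ex n \<phi> / a"
proof -
  have "bst_ex n (\<lambda>t. of_bool (\<phi> t \<ge> a)) \<le> bst_ex n (\<lambda>t. (1 / a) * \<phi> t)"
    using assms by (intro bst_ex_mono) (auto simp: field_simps)
  thus ?thesis by (simp only: bst_ex_cmult) simp
qed

lemma sum_diff_reindex: "(\<Sum>i\<le>n. h (n - i)) = (\<Sum>i\<le>n. h (i::nat))"
  by (rule sum.reindex_bij_witness[of _ "\<lambda>i. n - i" "\<lambda>i. n - i"]) auto

text \<open>An additive functional: the sum runs over vertices, so a shape occurring repeatedly
  counts with multiplicity.\<close>

primrec fringe_sum :: "(unit tree \<Rightarrow> real) \<Rightarrow> unit tree \<Rightarrow> real" where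
  "fringe_sum \<phi> Leaf = 0"
| "fringe_sum \<phi> (Node l a r) = \<phi> (Node l a r) + fringe_sum \<phi> l + fringe_sum \<phi> r"

text \<open>The quicksort recurrence: left and right sizes have the same uniform law, hence the
  factor 2.\<close>

lemma bst_ex_fringe_sum_Suc:
  "bst_ex (Suc n) (fringe_sum \<phi>) =
     bst_ex (Suc n) \<phi> + 2 / real (Suc n) * (\<Sum>i\<le>n. bst_ex i (fringe_sum \<phi>))"
proof -
  have "bst_ex (Suc n) (fringe_sum \<phi>) = bst_ex (Suc n) \<phi> +
     bst_ex (Suc n) (\<lambda>t. fringe_sum \<phi> t - \<phi> t)"
    by (simp flip: bst_ex_add)
  also have "bst_ex (Suc n) (\<lambda>t. fringe_sum \<phi> t - \<phi> t) =
      ((\<Sum>i\<le>n. bst_ex i (fringe_sum \<phi>)) + (\<Sum>i\<le>n. bst_ex (n - i) (fringe_sum \<phi>))) / real (Suc n)"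
    by (simp add: bst_ex_Suc bst_ex_add bst_ex_const sum.distrib)
  also have "(\<Sum>i\<le>n. bst_ex (n - i) (fringe_sum \<phi>)) = (\<Sum>i\<le>n. bst_ex i (fringe_sum \<phi>))"
    by (rule sum_diff_reindex)
  finally show ?thesis by (simp add: field_simps)
qed

lemma fringe_sum_mono:
  "(\<And>t. t \<noteq> Leaf \<Longrightarrow> size t \<le> size u \<Longrightarrow> \<phi> t \<le> \<psi> t) \<Longrightarrow> fringe_sum \<phi> u \<le> fringe_sum \<psi> u"
proof (induction u)
  case (Node l a r)
  have "fringe_sum \<phi> l \<le> fringe_sum \<psi> l" "fringe_sum \<phi> r \<le> fringe_sum \<psi> r"
       "\<phi> (Node l a r) \<le> \<psi> (Node l a r)"
    by (rule Node; (rule Node.prems)?; simp)+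
  thus ?case by simp
qed simp

lemma fringe_sum_nonneg: "(\<And>t. \<phi> t \<ge> 0) \<Longrightarrow> fringe_sum \<phi> u \<ge> 0"
  by (induction u) auto

lemma fringe_sum_sum: "fringe_sum (\<lambda>t. \<Sum>x\<in>A. \<phi> x t) u = (\<Sum>x\<in>A. fringe_sum (\<phi> x) u)"
  by (induction u) (auto simp: sum.distrib)

lemma fringe_sum_add: "fringe_sum (\<lambda>t. \<phi> t + \<psi> t) u = fringe_sum \<phi> u + fringe_sum \<psi> u"
  by (induction u) auto

text \<open>By the recurrence, the mean of a fringe sum is a nonnegative linear combination of the
  toll means at the various sizes, so a sizewise comparison carries over.\<close>

lemma bst_ex_fringe_sum_mono:
  assumes "\<And>k. k > 0 \<Longrightarrow> bst_ex k \<phi> \<le> c * bst_ex k \<psi>"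
  shows "bst_ex n (fringe_sum \<phi>) \<le> c * bst_ex n (fringe_sum \<psi>)"
proof (induction n rule: less_induct)
  case (less n)
  show ?case
  proof (cases n)
    case (Suc m)
    have "2 / real n * (\<Sum>i\<le>m. bst_ex i (fringe_sum \<phi>)) \<le> 2 / real n * (\<Sum>i\<le>m. c * bst_ex i (fringe_sum \<psi>))"
      using less Suc by (intro mult_left_mono sum_mono) auto
    also have "\<dots> = c * (2 / real n * (\<Sum>i\<le>m. bst_ex i (fringe_sum \<psi>)))"
      unfolding sum_distrib_left by (intro sum.cong) simp_all
    finally show ?thesis using assms[of n] unfolding Suc bst_ex_fringe_sum_Suc
      by (simp only: ring_distribs) simp
  qed (simp add: bst_ex_0)
qed

subsection \<open>Concentration for bounded tolls\<close>

lemma sums_inverse_consecutive: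
  "(\<lambda>k. 1 / ((real (k + n) + 1) * (real (k + n) + 2))) sums (1 / (real n + 1))"
proof -
  have "(\<lambda>k. 1 / (real (k + n) + 1)) \<longlonglongrightarrow> 0"
    by real_asymp
  from telescope_sums'[OF this] have
    "(\<lambda>k. 1 / (real (k + n) + 1) - 1 / (real (Suc k + n) + 1)) sums (1 / (real n + 1))"
    by simp
  also have "(\<lambda>k. 1 / (real (k + n) + 1) - 1 / (real (Suc k + n) + 1)) =
             (\<lambda>k. 1 / ((real (k + n) + 1) * (real (k + n) + 2)))"
    by (simp add: fun_eq_iff divide_simps add_eq_0_iff)
  finally show ?thesis .
qed

text \<open>The condition \<open>f 0 = 0\<close> matches \<open>fringe_sum\<close> vanishing on
  \<open>Leaf\<close>; through it \<open>mean 0\<close> below is the value of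
  \<open>centered\<close> at \<open>Leaf\<close>.\<close>

locale bounded_toll =
  fixes f :: "nat \<Rightarrow> real" and F :: real
  assumes f_0 [simp]: "f 0 = 0" and f_nonneg: "f k \<ge> 0" and f_le: "f k \<le> F"
begin

definition tail :: "nat \<Rightarrow> real" where
  "tail n = (\<Sum>k. f (k + n) / ((real (k + n) + 1) * (real (k + n) + 2)))"

definition rate :: real where "rate = 2 * tail 0"

text \<open>The factor \<open>size t + 1\<close>, the number of empty positions, is additive over
  the two subtrees of a node, so \<open>centered_Node\<close> needs no correction term.\<close>

definition centered :: "unit tree \<Rightarrow> real" where
  "centered t = fringe_sum (\<lambda>s. f (size s)) t - rate * (real (size t) + 1)"

lemma F_nonneg: "F \<ge> 0"
  using f_nonneg[of 0] f_le[of 0] by simp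

lemma summable_tail: "summable (\<lambda>k. f (k + n) / ((real (k + n) + 1) * (real (k + n) + 2)))"
proof (rule summable_comparison_test'[of "\<lambda>k. F * (1 / ((real (k + n) + 1) * (real (k + n) + 2)))" 0])
  show "summable (\<lambda>k. F * (1 / ((real (k + n) + 1) * (real (k + n) + 2))))"
    using sums_inverse_consecutive[of n] by (intro summable_mult) (auto simp: sums_iff)
qed (use f_nonneg f_le in \<open>auto intro!: divide_right_mono\<close>)

lemma tail_nonneg: "tail n \<ge> 0"
  unfolding tail_def by (intro suminf_nonneg summable_tail) (auto simp: f_nonneg)

lemma tail_le: "tail n \<le> F / (real n + 1)"
proof -
  have "tail n \<le> (\<Sum>k. F * (1 / ((real (k + n) + 1) * (real (k + n) + 2))))"
    unfolding tail_def using sums_inverse_consecutive[of n]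
    by (intro suminf_le summable_tail summable_mult)
       (auto simp: sums_iff intro!: divide_right_mono f_le)
  also have "\<dots> = F * (\<Sum>k. 1 / ((real (k + n) + 1) * (real (k + n) + 2)))"
    using sums_inverse_consecutive[of n] by (intro suminf_mult) (auto simp: sums_iff)
  also have "\<dots> = F / (real n + 1)"
    using sums_inverse_consecutive[of n] by (simp add: sums_iff)
  finally show ?thesis .
qed

lemma tail_rec: "tail n = f n / ((real n + 1) * (real n + 2)) + tail (Suc n)"
  unfolding tail_def using suminf_split_head[OF summable_tail[of n]] by simp

lemma rate_nonneg: "rate \<ge> 0"
  using tail_nonneg[of 0] by (simp add: rate_def)

lemma rate_le: "rate \<le> F"
proof -
  have "tail 1 \<le> F / 2" using tail_le[of 1] by simp
  thus ?thesis using tail_rec[of 0] by (simp add: rate_def)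
qed

lemma centered_Node:
  "centered (Node l x r) = f (Suc (size l + size r)) + centered l + centered r"
  by (simp add: centered_def algebra_simps)

text \<open>The quicksort recurrence solves to \<open>f n\<close> plus \<open>2 (n + 1)\<close>
  times the sum of \<open>f k / ((k + 1) (k + 2))\<close> over \<open>k < n\<close>. Subtracting
  \<open>rate * (n + 1)\<close> leaves minus the tail of that series.\<close>

definition mean :: "nat \<Rightarrow> real" where
  "mean n = f n - 2 * (real n + 1) * tail n"

text \<open>The closed form by which \<open>mean\<close> satisfies the recurrence
  \<open>mean n = f n + 2 / n * (\<Sum>j<n. mean j)\<close> for \<open>n > 0\<close>.\<close>

lemma sum_mean: "(\<Sum>j<n. mean j) = - real n * (real n + 1) * tail n"
proof (induction n)
  case (Suc n)
  have "f n = (tail n - tail (Suc n)) * ((real n + 1) * (real n + 2))"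
  proof -
    have "(real n + 1) * (real n + 2) \<noteq> 0"
      by (metis add_pos_nonneg mult_pos_pos of_nat_0_le_iff add.commute zero_less_one zero_less_numeral less_irrefl)
    thus ?thesis using tail_rec[of n] by (simp only: add_diff_cancel_right' nonzero_eq_divide_eq nonzero_divide_mult_cancel_right) simp
  qed
  thus ?case using Suc by (simp add: mean_def algebra_simps)
qed simp

lemma bst_ex_centered: "bst_ex n centered = mean n"
proof (induction n rule: less_induct)
  case (less n)
  show ?case
  proof (cases n)
    case 0
    thus ?thesis by (simp add: bst_ex_0 centered_def mean_def rate_def)
  next
    case (Suc m)
    have "bst_ex n centered = (\<Sum>i\<le>m. bst_ex i (\<lambda>l. bst_ex (m - i) (\<lambda>r. f n + centered l + centered r))) / n"
      unfolding Suc bst_ex_Suc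
      by (intro arg_cong2[of _ _ _ _ "(/)"] sum.cong bst_ex_cong refl) (auto simp: centered_Node Suc)
    also have "\<dots> = f n + ((\<Sum>i\<le>m. bst_ex i centered) + (\<Sum>i\<le>m. bst_ex (m - i) centered)) / n"
      using Suc by (simp add: bst_ex_add bst_ex_const sum.distrib add_divide_distrib)
    also have "(\<Sum>i\<le>m. bst_ex (m - i) centered) = (\<Sum>i\<le>m. bst_ex i centered)"
      by (rule sum_diff_reindex)
    also have "(\<Sum>i\<le>m. bst_ex i centered) = (\<Sum>i<n. mean i)"
      using less Suc by (intro sum.cong) auto
    also have "f n + ((\<Sum>i<n. mean i) + (\<Sum>i<n. mean i)) / n = mean n"
      using Suc unfolding sum_mean by (simp add: mean_def field_simps)
    finally show ?thesis .
  qed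
qed

lemma abs_mean_le: "\<bar>mean n\<bar> \<le> 2 * F"
proof -
  have "(real n + 1) * tail n \<le> F" using tail_le[of n] by (simp add: field_simps)
  moreover have "(real n + 1) * tail n \<ge> 0" using tail_nonneg[of n] by simp
  moreover have "mean n = f n - 2 * ((real n + 1) * tail n)" by (simp add: mean_def)
  ultimately show ?thesis using f_nonneg[of n] f_le[of n] F_nonneg by linarith
qed

text \<open>Expand the square of \<open>f (Suc n) + centered l + centered r\<close>. Given the split
  the subtrees are independent, so the cross term factors into means; the terms linear in
  \<open>centered\<close> are summed by \<open>sum_mean\<close>.\<close>

lemma bst_ex_centered_sq_rec:
  "bst_ex (Suc n) (\<lambda>t. centered t ^ 2) =
     2 * f (Suc n) * mean (Suc n) - f (Suc n) ^ 2 +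
     2 / real (Suc n) * ((\<Sum>i\<le>n. bst_ex i (\<lambda>t. centered t ^ 2)) + (\<Sum>i\<le>n. mean i * mean (n - i)))"
proof -
  define a where "a = f (Suc n)"
  define s where "s = (\<lambda>i. bst_ex i (\<lambda>t. centered t ^ 2))"
  have "bst_ex (Suc n) (\<lambda>t. centered t ^ 2) = (\<Sum>i\<le>n. bst_ex i (\<lambda>l. bst_ex (n - i) (\<lambda>r.
            a ^ 2 + centered l ^ 2 + centered r ^ 2 + (2 * a) * centered l + (2 * a) * centered r
            + (2 * centered l) * centered r))) / real (Suc n)"
    unfolding bst_ex_Suc
    by (intro arg_cong2[of _ _ _ _ "(/)"] sum.cong bst_ex_cong refl)
       (auto simp: centered_Node a_def power2_eq_square algebra_simps)
  also have "\<dots> = (\<Sum>i\<le>n. a ^ 2 + s i + s (n - i) + 2 * a * mean i + 2 * a * mean (n - i)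
                   + 2 * mean i * mean (n - i)) / real (Suc n)"
    by (simp only: bst_ex_add bst_ex_const bst_ex_cmult bst_ex_multc bst_ex_centered s_def)
  also have "(\<Sum>i\<le>n. a ^ 2 + s i + s (n - i) + 2 * a * mean i + 2 * a * mean (n - i)
                   + 2 * mean i * mean (n - i)) =
     real (Suc n) * a ^ 2 + (\<Sum>i\<le>n. s i) + (\<Sum>i\<le>n. s (n - i)) + 2 * a * (\<Sum>i\<le>n. mean i)
     + 2 * a * (\<Sum>i\<le>n. mean (n - i)) + 2 * (\<Sum>i\<le>n. mean i * mean (n - i))"
    by (simp add: sum.distrib sum_distrib_left mult.assoc)
  also have "\<dots> = real (Suc n) * a ^ 2 + 2 * (\<Sum>i\<le>n. s i) + 4 * a * (\<Sum>i\<le>n. mean i)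
                   + 2 * (\<Sum>i\<le>n. mean i * mean (n - i))"
    by (simp only: sum_diff_reindex)
  also have "(\<Sum>i\<le>n. mean i) = real (Suc n) * (mean (Suc n) - a) / 2"
  proof -
    have "mean (Suc n) - a = - 2 * (real n + 2) * tail (Suc n)"
      by (simp add: mean_def a_def algebra_simps)
    thus ?thesis using sum_mean[of "Suc n"]
      by (simp only: lessThan_Suc_atMost) (simp add: field_simps)
  qed
  finally show ?thesis
    by (simp add: a_def s_def field_simps power2_eq_square)
qed

lemma bst_ex_centered_sq: "bst_ex n (\<lambda>t. centered t ^ 2) \<le> 13 * F ^ 2 * (real n + 1)"
proof -
  \<comment> \<open>Strengthened for the induction. Averaging \<open>A (n + 1) - B\<close> through
    the recurrence gives \<open>A (n + 1) - 2 B\<close>, and the gained \<open>B\<close> absorbs the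
    inhomogeneous terms \<open>4 F^2 + 8 F^2\<close>: hence \<open>B = 12 F^2\<close>. At size 0 the
    value is at most \<open>F^2\<close>, hence \<open>A = 13 F^2\<close>.\<close>
  have "bst_ex n (\<lambda>t. centered t ^ 2) \<le> 13 * F ^ 2 * (real n + 1) - 12 * F ^ 2"
  proof (induction n rule: less_induct)
    case (less n)
    show ?case
    proof (cases n)
      case 0
      have "rate ^ 2 \<le> F ^ 2" using rate_le rate_nonneg by (intro power_mono)
      thus ?thesis using 0 by (simp add: bst_ex_0 centered_def)
    next
      case (Suc m)
      define S where "S = (\<Sum>i\<le>m. bst_ex i (\<lambda>t. centered t ^ 2))"
      define T where "T = (\<Sum>i\<le>m. mean i * mean (m - i))"
      have "f n * mean n \<le> f n * (2 * F)"
        using abs_mean_le[of n] f_nonneg[of n] by (intro mult_left_mono) auto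
      also have "\<dots> \<le> F * (2 * F)"
        using f_le[of n] F_nonneg by (intro mult_right_mono) auto
      finally have "f n * mean n \<le> 2 * F ^ 2" by (simp add: power2_eq_square)
      moreover have "f n ^ 2 \<ge> 0" by simp
      ultimately have A: "2 * f n * mean n - f n ^ 2 \<le> 4 * F ^ 2"
        unfolding mult.assoc by linarith
      have "mean i * mean j \<le> 4 * F ^ 2" for i j
      proof -
        have "\<bar>mean i * mean j\<bar> \<le> (2 * F) * (2 * F)"
          unfolding abs_mult by (intro mult_mono abs_mean_le) (simp_all add: F_nonneg)
        thus ?thesis by (simp add: power2_eq_square)
      qed
      hence "T \<le> (\<Sum>i\<le>m. 4 * F ^ 2)"
        unfolding T_def by (rule sum_mono)
      hence B: "T \<le> real n * (4 * F ^ 2)" using Suc by simp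
      have "S \<le> (\<Sum>i\<le>m. 13 * F ^ 2 * (real i + 1) - 12 * F ^ 2)"
        unfolding S_def by (rule sum_mono, rule less) (use Suc in simp)
      also have "\<dots> = 13 * F ^ 2 * (real (Suc m) * (real (Suc m) + 1) / 2) - 12 * real (Suc m) * F ^ 2"
        by (induction m) (simp_all add: algebra_simps)
      finally have C: "S \<le> 13 * F ^ 2 * (real n * (real n + 1) / 2) - 12 * real n * F ^ 2"
        unfolding Suc .
      have "2 / real n * (S + T)
         \<le> 2 / real n * (13 * F ^ 2 * (real n * (real n + 1) / 2) - 12 * real n * F ^ 2 + real n * (4 * F ^ 2))"
        by (rule mult_left_mono[OF add_mono[OF C B]]) simp
      also have "\<dots> = 13 * F ^ 2 * (real n + 1) - 16 * F ^ 2"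
        using Suc by (simp add: field_simps)
      finally show ?thesis using A unfolding Suc bst_ex_centered_sq_rec S_def T_def by linarith
    qed
  qed
  moreover have "F ^ 2 \<ge> 0" by simp
  ultimately show ?thesis by linarith
qed

text \<open>Chebyshev's inequality about 0 rather than about \<open>mean n\<close>, since the raw
  second moment is what has been bounded.\<close>

lemma bst_ex_deviation:
  assumes "a > 0"
  shows "bst_ex n (\<lambda>t. of_bool (\<bar>centered t\<bar> \<ge> a)) \<le> 13 * F ^ 2 * (real n + 1) / a ^ 2"
proof -
  have "bst_ex n (\<lambda>t. of_bool (\<bar>centered t\<bar> \<ge> a)) \<le> bst_ex n (\<lambda>t. of_bool (centered t ^ 2 \<ge> a ^ 2))"
    using assms abs_le_square_iff[of a] by (intro bst_ex_mono) auto
  also have "\<dots> \<le> bst_ex n (\<lambda>t. centered t ^ 2) / a ^ 2"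
    using assms by (intro bst_ex_markov) auto
  also have "\<dots> \<le> 13 * F ^ 2 * (real n + 1) / a ^ 2"
    by (intro divide_right_mono bst_ex_centered_sq) auto
  finally show ?thesis .
qed

end

section \<open>The two tolls: large fringe subtrees and truncated logarithms\<close>

definition at_least :: "nat \<Rightarrow> nat \<Rightarrow> real" where
  "at_least m k = of_bool (k \<ge> m)"

lemma bounded_toll_at_least: "m > 0 \<Longrightarrow> bounded_toll (at_least m) 1"
  by unfold_locales (auto simp: at_least_def)

text \<open>Tolls below \<open>m\<close> vanish, so \<open>tail 0 = tail m\<close>, and the latter
  telescopes.\<close>

lemma rate_at_least: 
  assumes "m > 0"
  shows "bounded_toll.rate (at_least m) = 2 / (real m + 1)"
proof -
  interpret bounded_toll "at_least m" 1 using assms by (rule bounded_toll_at_least)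
  have "k \<le> m \<Longrightarrow> tail 0 = tail k" for k
  proof (induction k)
    case (Suc k)
    have "at_least m k = 0" using Suc.prems by (simp add: at_least_def)
    thus ?case using Suc tail_rec[of k] by simp
  qed simp
  hence "tail 0 = tail m" by simp
  also have "\<dots> = 1 / (real m + 1)"
    using sums_inverse_consecutive[of m] by (simp add: tail_def at_least_def sums_iff)
  finally show ?thesis by (simp add: rate_def)
qed

text \<open>The cut at \<open>M\<close> makes the logarithm a bounded toll. At \<open>k = 0\<close>
  the convention \<open>ln 0 = 0\<close> gives the required toll 0.\<close>

definition trunc_ln :: "nat \<Rightarrow> nat \<Rightarrow> real" where
  "trunc_ln M k = (if k \<le> M then ln (real k) else 0)"

lemma bounded_toll_trunc_ln: "bounded_toll (trunc_ln M) (ln (real (Suc M)))"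
proof
  fix k
  show "trunc_ln M k \<ge> 0" "trunc_ln M k \<le> ln (real (Suc M))"
    by (cases k; auto simp: trunc_ln_def)+
qed (auto simp: trunc_ln_def)

lemma rate_trunc_ln_tendsto: "(\<lambda>M. bounded_toll.rate (trunc_ln M)) \<longlonglongrightarrow> c5 / 2"
proof -
  define g where "g = (\<lambda>k. ln (real k) / ((real k + 1) * (real k + 2)))"
  have "(\<lambda>k. g (Suc k)) sums (c5 / 4)"
    using summable_c5 by (simp add: sums_iff c5_def g_def)
  \<comment> \<open>The series of \<open>c5\<close> starts at 1; the term added at 0 vanishes
    because \<open>ln 0 = 0\<close>.\<close>
  hence "g sums (c5 / 4)"
    by (subst (asm) sums_Suc_iff) (simp add: g_def)
  hence "(\<lambda>M. 2 * (\<Sum>k\<le>M. g k)) \<longlonglongrightarrow> 2 * (c5 / 4)"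
    unfolding sums_def_le by (rule tendsto_mult_left)
  also have "(\<lambda>M. 2 * (\<Sum>k\<le>M. g k)) = (\<lambda>M. bounded_toll.rate (trunc_ln M))"
  proof
    fix M
    interpret bounded_toll "trunc_ln M" "ln (real (Suc M))" by (rule bounded_toll_trunc_ln)
    have "tail 0 = (\<Sum>k. trunc_ln M k / ((real k + 1) * (real k + 2)))" by (simp add: tail_def)
    also have "\<dots> = (\<Sum>k\<le>M. trunc_ln M k / ((real k + 1) * (real k + 2)))"
      by (rule suminf_finite) (auto simp: trunc_ln_def)
    also have "\<dots> = (\<Sum>k\<le>M. g k)"
      by (intro sum.cong) (auto simp: trunc_ln_def g_def)
    finally show "2 * (\<Sum>k\<le>M. g k) = rate" by (simp add: rate_def)
  qed
  finally show ?thesis by simp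
qed

subsection \<open>The shape of a random binary search tree\<close>

lemma shape_simps [simp]:
  "shape Leaf = Leaf" "shape (Node l a r) = Node (shape l) () (shape r)"
  by (simp_all add: shape_def)

lemma shape_eq_Leaf [simp]: "shape t = Leaf \<longleftrightarrow> t = Leaf"
  by (cases t) auto

lemma subtrees_shape: "subtrees (shape t) = shape ` subtrees t"
  by (induction t) auto

lemma num_distinct_fringe_shape:
  "num_distinct_fringe t = card (subtrees (shape t) - {Leaf})"
proof -
  have "shape ` (subtrees t - {Leaf}) = subtrees (shape t) - {Leaf}"
    by (auto simp: subtrees_shape)
  thus ?thesis by (simp add: num_distinct_fringe_def fringe_subtrees_def)
qed

text \<open>The first key stays at the root, and later keys descend to its left or right, keeping
  their order of insertion within each side.\<close>

lemma bst_of_list_Cons: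
  "bst_of_list (x # xs) =
     Node (bst_of_list (filter (\<lambda>y. y < x) xs)) x (bst_of_list (filter (\<lambda>y. y > x) xs))"
proof -
  have "fold bst_insert xs (Node l x r) =
          Node (fold bst_insert (filter (\<lambda>y. y < x) xs) l) x
               (fold bst_insert (filter (\<lambda>y. y > x) xs) r)" for l r
    by (induction xs arbitrary: l r) auto
  thus ?thesis by (simp add: bst_of_list_def)
qed

text \<open>Arbitrary key sets are allowed because the keys above the root do not form an interval
  starting at 1.\<close>

definition shape_pmf :: "'a::linorder set \<Rightarrow> unit tree pmf" where
  "shape_pmf A = map_pmf (\<lambda>xs. shape (bst_of_list xs)) (pmf_of_set (permutations_of_set A))"

text \<open>The first key is uniform and the rest is a uniform permutation of the other keys.
  Splitting a uniform permutation by a predicate yields two independent uniform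
  permutations.\<close>

lemma shape_pmf_rec:
  assumes "finite A" "A \<noteq> {}"
  shows "shape_pmf A = pmf_of_set A \<bind> (\<lambda>x. map_pmf (\<lambda>(l, r). Node l () r)
           (pair_pmf (shape_pmf {y\<in>A. y < x}) (shape_pmf {y\<in>A. y > x})))"
proof -
  let ?B = "\<lambda>xs. shape (bst_of_list xs)"
  have "shape_pmf A = pmf_of_set A \<bind> (\<lambda>x. map_pmf (\<lambda>xs. ?B (x # xs)) 
          (pmf_of_set (permutations_of_set (A - {x}))))"
    unfolding shape_pmf_def random_permutation_of_set[OF assms]
    by (simp only: map_pmf_def bind_assoc_pmf bind_return_pmf o_def)
  also have "\<dots> = pmf_of_set A \<bind> (\<lambda>x. map_pmf (\<lambda>(l, r). Node l () r)
           (pair_pmf (shape_pmf {y\<in>A. y < x}) (shape_pmf {y\<in>A. y > x})))"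
  proof (intro bind_pmf_cong refl)
    fix x assume "x \<in> set_pmf (pmf_of_set A)"
    hence x: "x \<in> A" using assms by simp
    have fin: "finite (A - {x})" using assms by simp
    have "map_pmf (\<lambda>xs. ?B (x # xs)) (pmf_of_set (permutations_of_set (A - {x}))) =
          map_pmf (\<lambda>xs. Node (?B (filter (\<lambda>y. y < x) xs)) () (?B (filter (\<lambda>y. \<not>y < x) xs)))
            (pmf_of_set (permutations_of_set (A - {x})))"
    proof (intro map_pmf_cong refl)
      fix xs assume "xs \<in> set_pmf (pmf_of_set (permutations_of_set (A - {x})))"
      hence "xs \<in> permutations_of_set (A - {x})"
        by (subst (asm) set_pmf_of_set) (use fin in auto)
      hence "set xs = A - {x}" by (rule permutations_of_setD)
      hence "filter (\<lambda>y. y > x) xs = filter (\<lambda>y. \<not>y < x) xs"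
        by (intro filter_cong) (auto simp: not_less_iff_gr_or_eq)
      thus "?B (x # xs) = Node (?B (filter (\<lambda>y. y < x) xs)) () (?B (filter (\<lambda>y. \<not>y < x) xs))"
        by (simp add: bst_of_list_Cons)
    qed
    also have "\<dots> = map_pmf (\<lambda>(l, r). Node l () r) (map_pmf (map_prod ?B ?B)
        (map_pmf (partition (\<lambda>y. y < x)) (pmf_of_set (permutations_of_set (A - {x})))))"
      by (simp only: pmf.map_comp o_def partition_filter_conv map_prod_simp prod.case)
    also have "\<dots> = map_pmf (\<lambda>(l, r). Node l () r)
        (pair_pmf (shape_pmf {y\<in>A-{x}. y < x}) (shape_pmf {y\<in>A-{x}. \<not>y < x}))"
      unfolding partition_random_permutations[OF fin] shape_pmf_def map_prod_def map_pair ..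
    also have "\<dots> = map_pmf (\<lambda>(l, r). Node l () r)
           (pair_pmf (shape_pmf {y\<in>A. y < x}) (shape_pmf {y\<in>A. y > x}))"
    proof -
      have "{y\<in>A-{x}. y < x} = {y\<in>A. y < x}" "{y\<in>A-{x}. \<not>y < x} = {y\<in>A. y > x}"
        by (auto simp: not_less_iff_gr_or_eq)
      thus ?thesis by (simp only:)
    qed
    finally show "map_pmf (\<lambda>xs. ?B (x # xs)) (pmf_of_set (permutations_of_set (A - {x}))) =
        map_pmf (\<lambda>(l, r). Node l () r)
           (pair_pmf (shape_pmf {y\<in>A. y < x}) (shape_pmf {y\<in>A. y > x}))" .
  qed
  finally show ?thesis .
qed

text \<open>Turns a sum over root keys into a sum over the size of the left subtree.\<close>

lemma bij_betw_rank:
  fixes A :: "'a::linorder set"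
  assumes "finite A"
  shows "bij_betw (\<lambda>x. card {y\<in>A. y < x}) A {..<card A}"
proof -
  have less: "card {y\<in>A. y < x} < card {y\<in>A. y < x'}" if "x \<in> A" "x < x'" for x x'
    using that assms by (intro psubset_card_mono) auto
  have inj: "inj_on (\<lambda>x. card {y\<in>A. y < x}) A"
  proof (rule inj_onI)
    fix x x' assume "x \<in> A" "x' \<in> A" "card {y\<in>A. y < x} = card {y\<in>A. y < x'}"
    thus "x = x'" using less[of x x'] less[of x' x] by (cases x x' rule: linorder_cases) auto
  qed
  have "(\<lambda>x. card {y\<in>A. y < x}) ` A \<subseteq> {..<card A}"
  proof safe
    fix x assume "x \<in> A"
    thus "card {y\<in>A. y < x} < card A"
      using assms by (intro psubset_card_mono) auto
  qed
  moreover have "card ((\<lambda>x. card {y\<in>A. y < x}) ` A) = card {..<card A}"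
    using inj by (simp add: card_image)
  ultimately have "(\<lambda>x. card {y\<in>A. y < x}) ` A = {..<card A}"
    by (intro card_subset_eq) auto
  with inj show ?thesis by (simp add: bij_betw_def)
qed

text \<open>Only the root key of rank \<open>size l\<close> leaves a left subtree of the right size,
  so at most one term of the sum over roots survives; division by \<open>card A\<close> supplies the
  root's factor in \<open>wt\<close>.\<close>

lemma pmf_shape_pmf:
  assumes "finite A"
  shows "pmf (shape_pmf A) t = (if size t = card A then wt t else 0)"
  using assms
proof (induction t arbitrary: A)
  case Leaf
  show ?case
  proof (cases "A = {}")
    case True
    thus ?thesis by (simp add: shape_pmf_def bst_of_list_def pmf_of_set_singleton)
  next
    case False
    have "pmf (shape_pmf A) Leaf = 0"
      unfolding pmf_eq_0_set_pmf shape_pmf_rec[OF Leaf False] by (auto simp: case_prod_unfold)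
    thus ?thesis using False Leaf by simp
  qed
next
  case (Node l u r A)
  show ?case
  proof (cases "A = {}")
    case True
    thus ?thesis by (simp add: shape_pmf_def bst_of_list_def pmf_of_set_singleton)
  next
    case False
    let ?N = "\<lambda>(l, r). Node l () r"
    have inj: "inj ?N" by (auto simp: inj_on_def)
    have card: "card {y\<in>A. y < x} + card {y\<in>A. y > x} + 1 = card A" if "x \<in> A" for x
    proof -
      have "A = insert x ({y\<in>A. y < x} \<union> {y\<in>A. y > x})" using that by auto
      moreover have "card \<dots> = Suc (card ({y\<in>A. y < x} \<union> {y\<in>A. y > x}))"
        using Node.prems by (subst card_insert_disjoint) auto
      moreover have "card ({y\<in>A. y < x} \<union> {y\<in>A. y > x}) = card {y\<in>A. y < x} + card {y\<in>A. y > x}"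
        using Node.prems by (intro card_Un_disjoint) auto
      ultimately show ?thesis by simp
    qed
    have "pmf (shape_pmf A) (Node l u r) =
      (\<Sum>x\<in>A. pmf (map_pmf ?N (pair_pmf (shape_pmf {y\<in>A. y < x}) (shape_pmf {y\<in>A. y > x}))) (?N (l, r))) / card A"
      unfolding shape_pmf_rec[OF Node.prems False]
      unfolding pmf_bind_pmf_of_set[OF False Node.prems] by simp
    also have "\<dots> = (\<Sum>x\<in>A. pmf (shape_pmf {y\<in>A. y < x}) l * pmf (shape_pmf {y\<in>A. y > x}) r) / card A"
      unfolding pmf_map_inj'[OF inj] pmf_pair ..
    also have "(\<Sum>x\<in>A. pmf (shape_pmf {y\<in>A. y < x}) l * pmf (shape_pmf {y\<in>A. y > x}) r) =
       (\<Sum>x\<in>A. if card {y\<in>A. y < x} = size l then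
                 (if size l + size r + 1 = card A then wt l * wt r else 0) else 0)"
    proof (intro sum.cong refl, goal_cases)
      case (1 x)
      have "finite {y\<in>A. y < x}" "finite {y\<in>A. y > x}" using Node.prems by auto
      hence IH: "pmf (shape_pmf {y\<in>A. y < x}) l = (if size l = card {y\<in>A. y < x} then wt l else 0)"
          "pmf (shape_pmf {y\<in>A. y > x}) r = (if size r = card {y\<in>A. y > x} then wt r else 0)"
        using Node.IH(1)[of "{y\<in>A. y < x}"] Node.IH(2)[of "{y\<in>A. y > x}"] by simp_all
      define i j where "i = card {y\<in>A. y < x}" and "j = card {y\<in>A. y > x}"
      have "card A = i + j + 1" using card[OF 1] by (simp add: i_def j_def)
      thus ?case unfolding IH i_def [symmetric] j_def [symmetric] by auto
    qed
    also have "\<dots> = (\<Sum>i<card A. if i = size l then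
                 (if size l + size r + 1 = card A then wt l * wt r else 0) else 0)"
      by (rule sum.reindex_bij_betw[OF bij_betw_rank[OF Node.prems]])
    also have "\<dots> = (if size l + size r + 1 = card A then wt l * wt r else 0)"
      by (simp add: sum.delta)
    finally show ?thesis by (simp only: tree.size wt.simps) (simp split: if_splits)
  qed
qed

lemma shape_random_bst: "map_pmf shape (random_bst n) = shape_pmf {1..n}"
  by (simp add: random_bst_def shape_pmf_def map_pmf_comp)

lemma expectation_random_bst:
  "measure_pmf.expectation (random_bst n) (\<lambda>t. \<phi> (shape t)) = bst_ex n \<phi>"
proof -
  have "measure_pmf.expectation (random_bst n) (\<lambda>t. \<phi> (shape t)) =
        measure_pmf.expectation (shape_pmf {1..n}) \<phi>"
    unfolding shape_random_bst[symmetric] by simp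
  also have "\<dots> = (\<Sum>t\<in>shapes n. \<phi> t * pmf (shape_pmf {1..n}) t)"
    by (rule integral_measure_pmf_real[OF finite_shapes])
       (auto simp: shapes_def set_pmf_iff pmf_shape_pmf split: if_splits)
  also have "\<dots> = bst_ex n \<phi>"
    unfolding bst_ex_def by (intro sum.cong) (auto simp: pmf_shape_pmf shapes_def)
  finally show ?thesis .
qed

lemma prob_random_bst:
  "measure_pmf.prob (random_bst n) {t. P (shape t)} = bst_ex n (\<lambda>t. of_bool (P t))"
proof -
  have "measure_pmf.prob (random_bst n) {t. P (shape t)} =
          measure_pmf.expectation (random_bst n) (indicator {t. P (shape t)})"
    by simp
  also have "(indicator {t. P (shape t)} :: nat tree \<Rightarrow> real) = (\<lambda>t. of_bool (P (shape t)))"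
    by (auto simp: indicator_def)
  finally show ?thesis using expectation_random_bst[of n "\<lambda>t. of_bool (P t)"] by simp
qed

subsection \<open>Counting distinct fringe subtrees\<close>

lemma finite_subtrees: "finite (subtrees t)"
  by (induction t) auto

text \<open>Every distinct subtree is carried by at least one vertex, and the fringe sum runs over
  all vertices.\<close>

lemma card_subtrees_le_fringe_sum:
  "real (card {s \<in> subtrees t - {Leaf}. P s}) \<le> fringe_sum (\<lambda>s. of_bool (P s)) t"
proof (induction t)
  case (Node l a r)
  define S where "S = (\<lambda>t. {s \<in> subtrees t - {Leaf}. P s})"
  define R where "R = {s. s = Node l a r \<and> P s}"
  have "finite (S t)" for t using finite_subtrees[of t] by (simp add: S_def)
  moreover have "finite R" by (simp add: R_def)
  moreover have "S (Node l a r) \<subseteq> R \<union> (S l \<union> S r)" by (auto simp: S_def R_def)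
  ultimately have "card (S (Node l a r)) \<le> card (R \<union> (S l \<union> S r))"
    by (intro card_mono) simp_all
  also have "\<dots> \<le> card R + card (S l \<union> S r)" by (rule card_Un_le)
  also have "card (S l \<union> S r) \<le> card (S l) + card (S r)" by (rule card_Un_le)
  finally have "real (card (S (Node l a r))) \<le> real (card R) + real (card (S l)) + real (card (S r))"
    by simp
  moreover have "real (card R) = of_bool (P (Node l a r))"
    by (cases "P (Node l a r)") (simp_all add: R_def conj_commute cong: conj_cong)
  ultimately show ?case using Node by (simp add: S_def)
qed simp

text \<open>The generating function of binary trees at its radius of convergence. Cut off at height
  \<open>h\<close>, it obeys the iteration \<open>X \<mapsto> 1 + X^2 / 4\<close>, which stays below
  its fixed point 2.\<close>

lemma sum_quarter_power_height:
  "finite {t :: unit tree. height t \<le> h} \<and>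
   (\<Sum>t | height (t :: unit tree) \<le> h. (1 / 4 :: real) ^ size t) \<le> 2"
proof (induction h)
  case 0
  have "{t :: unit tree. height t \<le> 0} = {Leaf}" by auto
  thus ?case by simp
next
  case (Suc h)
  define U where "U = {t :: unit tree. height t \<le> h}"
  define N where "N = (\<lambda>(l, r). Node l () r)"
  define X :: real where "X = (\<Sum>t\<in>U. (1 / 4) ^ size t)"
  have inj: "inj_on N A" for A by (auto simp: inj_on_def N_def)
  have fin: "finite (U \<times> U)" using Suc by (simp add: U_def)
  have U': "{t :: unit tree. height t \<le> Suc h} = insert Leaf (N ` (U \<times> U))"
  proof (intro set_eqI iffI)
    fix t :: "unit tree" assume t: "t \<in> {t. height t \<le> Suc h}"
    show "t \<in> insert Leaf (N ` (U \<times> U))"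
    proof (cases t)
      case (Node l a r)
      thus ?thesis using t by (intro insertI2 image_eqI[of _ _ "(l, r)"]) (auto simp: N_def U_def)
    qed simp
  qed (auto simp: N_def U_def)
  have "Leaf \<notin> N ` (U \<times> U)" by (auto simp: N_def)
  hence "(\<Sum>t\<in>insert Leaf (N ` (U \<times> U)). (1 / 4 :: real) ^ size t) =
          1 + (\<Sum>t\<in>N ` (U \<times> U). (1 / 4) ^ size t)"
    using fin by (subst sum.insert) simp_all
  also have "(\<Sum>t\<in>N ` (U \<times> U). (1 / 4 :: real) ^ size t) =
               (\<Sum>x\<in>U \<times> U. (1 / 4) ^ size (N x))"
    by (subst sum.reindex[OF inj]) (simp only: o_def)
  also have "\<dots> = (\<Sum>(l, r)\<in>U \<times> U. (1 / 4) ^ size l * (1 / 4) ^ size r) / 4"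
    unfolding sum_divide_distrib by (intro sum.cong) (auto simp: N_def power_add)
  also have "(\<Sum>(l, r)\<in>U \<times> U. (1 / 4) ^ size l * (1 / 4) ^ size r) = X * X"
    unfolding X_def sum_product by (rule sum.cartesian_product [symmetric])
  finally have eq: "(\<Sum>t\<in>insert Leaf (N ` (U \<times> U)). (1 / 4 :: real) ^ size t) = 1 + X * X / 4" .
  have "X \<ge> 0" unfolding X_def by (intro sum_nonneg) simp
  moreover have "X \<le> 2" using Suc by (simp add: X_def U_def)
  ultimately have "X * X \<le> 2 * 2" by (intro mult_mono) simp_all
  with eq fin show ?case unfolding U' by simp
qed

text \<open>Each tree of size below \<open>m\<close> has height at most \<open>m\<close> and
  contributes at least \<open>(1 / 4) ^ m\<close> to the preceding sum.\<close>

lemma card_size_less: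
  "finite {t :: unit tree. size t < m}" "real (card {t :: unit tree. size t < m}) \<le> 2 * 4 ^ m"
proof -
  let ?S = "{t :: unit tree. size t < m}"
  have sub: "?S \<subseteq> {t. height t \<le> m}"
    using height_le_size_tree le_trans less_imp_le by blast
  show fin: "finite ?S"
    using finite_subset[OF sub] sum_quarter_power_height[of m] by auto
  have "real (card ?S) * (1 / 4) ^ m = (\<Sum>t\<in>?S. (1 / 4) ^ m)" by simp
  also have "\<dots> \<le> (\<Sum>t\<in>?S. (1 / 4) ^ size t)"
    by (intro sum_mono power_decreasing) auto
  also have "\<dots> \<le> (\<Sum>t | height (t :: unit tree) \<le> m. (1 / 4) ^ size t)"
    using sum_quarter_power_height[of m] by (intro sum_mono2 sub) auto
  also have "\<dots> \<le> 2" using sum_quarter_power_height[of m] by auto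
  finally show "real (card ?S) \<le> 2 * 4 ^ m"
    by (simp add: field_simps)
qed

lemma card_subtrees_upper:
  "real (card (subtrees t - {Leaf})) \<le> 2 * 4 ^ m + fringe_sum (\<lambda>s. of_bool (size s \<ge> m)) t"
proof -
  have "card (subtrees t - {Leaf}) \<le>
          card ({t. size t < m} \<union> {s\<in>subtrees t - {Leaf}. size s \<ge> m})"
  proof (rule card_mono)
    show "finite ({t. size t < m} \<union> {s\<in>subtrees t - {Leaf}. size s \<ge> m})"
      using card_size_less(1)[of m] finite_subtrees[of t] by simp
  qed auto
  also have "\<dots> \<le> card {t :: unit tree. size t < m} + card {s\<in>subtrees t - {Leaf}. size s \<ge> m}"
    by (rule card_Un_le)
  finally have "real (card (subtrees t - {Leaf})) \<le> real (card {t :: unit tree. size t < m}) +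
                  real (card {s\<in>subtrees t - {Leaf}. size s \<ge> m})" by linarith
  thus ?thesis using card_size_less(2)[of m] card_subtrees_le_fringe_sum[of t "\<lambda>s. size s \<ge> m"]
    by linarith
qed

section \<open>Moments of the number of occurrences of a fixed shape\<close>

definition occ :: "unit tree \<Rightarrow> unit tree \<Rightarrow> real" where
  "occ s = fringe_sum (\<lambda>u. of_bool (u = s))"

lemma wt_nonneg [simp]: "wt t \<ge> 0" and wt_neq_0 [simp]: "wt t \<noteq> 0"
  using wt_pos[of t] by simp_all

lemma occ_eq_0_if_size_less: "size t < size s \<Longrightarrow> occ s t = 0"
  unfolding occ_def by (induction t) auto

lemma occ_eq_0_if_notin: "s \<notin> subtrees t \<Longrightarrow> occ s t = 0"
  unfolding occ_def by (induction t) auto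

lemma occ_nonneg: "occ s t \<ge> 0"
  unfolding occ_def by (rule fringe_sum_nonneg) auto

lemma occ_Nats: "occ s t \<in> \<nat>"
  unfolding occ_def by (induction t) auto

text \<open>Summed over \<open>s\<close>, this bounds the number of shapes that occur from below by first and second
  factorial moments.\<close>
lemma occ_minus_pairs_le_1: "occ s t - occ s t * (occ s t - 1) \<le> 1"
proof -
  have "(occ s t - 1) ^ 2 \<ge> 0" by simp
  thus ?thesis by (simp add: power2_eq_square algebra_simps)
qed

text \<open>This rests on \<open>occ s t\<close> being a natural number. It allows Markov's
  inequality for \<open>collisions\<close>.\<close>

lemma occ_pairs_nonneg: "occ s t * (occ s t - 1) \<ge> 0"
proof -
  obtain k where "occ s t = of_nat k" using occ_Nats Nats_cases by metis
  thus ?thesis by (cases k) auto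
qed

lemma occ_Node: "occ s (Node l x r) = of_bool (Node l x r = s) + occ s l + occ s r"
  by (simp add: occ_def)

lemma bst_ex_eq_shape: "bst_ex n (\<lambda>u. of_bool (u = s)) = (if size s = n then wt s else 0)"
proof -
  have "bst_ex n (\<lambda>u. of_bool (u = s)) = (\<Sum>t\<in>shapes n. if t = s then wt s else 0)"
    unfolding bst_ex_def by (intro sum.cong) auto
  also have "\<dots> = (if s \<in> shapes n then wt s else 0)"
    by (rule sum.delta[OF finite_shapes])
  finally show ?thesis by (simp add: shapes_def)
qed

lemma sum_upto_real: "(\<Sum>i\<le>m. real i) = real m * (real m + 1) / 2"
  by (induction m) (auto simp: field_simps)

text \<open>At the size of \<open>s\<close> itself only the root can match, with probability
  \<open>wt s\<close>. At any other size the root never matches, and averaging the bound over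
  smaller sizes gives \<open>wt s * (n - 1)\<close>.\<close>

lemma bst_ex_occ:
  assumes "s \<noteq> Leaf"
  shows "bst_ex n (occ s) \<le> wt s * real n"
proof (induction n rule: less_induct)
  case (less n)
  show ?case
  proof (cases n)
    case 0
    thus ?thesis using assms by (simp add: bst_ex_0 occ_def)
  next
    case (Suc m)
    have rec: "bst_ex n (occ s) = bst_ex n (\<lambda>u. of_bool (u = s)) +
                 2 / real n * (\<Sum>i\<le>m. bst_ex i (occ s))"
      unfolding occ_def Suc by (rule bst_ex_fringe_sum_Suc)
    show ?thesis
    proof (cases "size s = n")
      case True
      have "bst_ex i (occ s) = 0" if "i \<le> m" for i
        using bst_ex_cong[of i "occ s" "\<lambda>_. 0"] that True Suc
        by (simp add: occ_eq_0_if_size_less bst_ex_const)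
      thus ?thesis using rec True Suc wt_pos[of s] by (simp add: bst_ex_eq_shape)
    next
      case False
      have "(\<Sum>i\<le>m. bst_ex i (occ s)) \<le> (\<Sum>i\<le>m. wt s * real i)"
        using less Suc by (intro sum_mono) auto
      also have "\<dots> = wt s * (real m * real n / 2)"
        using Suc by (simp add: sum_upto_real flip: sum_distrib_left)
      finally have "2 / real n * (\<Sum>i\<le>m. bst_ex i (occ s)) \<le> 2 / real n * (wt s * (real m * real n / 2))"
        by (intro mult_left_mono) auto
      also have "\<dots> = wt s * real m" using Suc by simp
      also have "\<dots> \<le> wt s * real n" using Suc wt_pos[of s] by (intro mult_left_mono) auto
      finally show ?thesis using rec False by (simp add: bst_ex_eq_shape)
    qed
  qed
qed

text \<open>In a tree larger than \<open>s\<close> an ordered pair of occurrences lies in one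
  subtree or is split between both; split pairs contribute products of means. From a constant
  \<open>K\<close> the recurrence returns \<open>2 K / 3 + 2\<close>, which equals \<open>K\<close>
  at 6.\<close>

lemma bst_ex_occ_pairs:
  assumes "s \<noteq> Leaf"
  shows "bst_ex n (\<lambda>t. occ s t * (occ s t - 1)) \<le> 6 * wt s ^ 2 * real n ^ 2"
proof (induction n rule: less_induct)
  case (less n)
  let ?Q = "\<lambda>t. occ s t * (occ s t - 1)"
  show ?case
  proof (cases "n \<le> size s")
    case True
    \<comment> \<open>A tree no larger than \<open>s\<close> can match \<open>s\<close> only at its
      root, so there is no pair.\<close>
    have "?Q t = 0" if "size t = n" for t
    proof (cases t)
      case (Node l a r)
      hence "occ s t = of_bool (t = s)"
        using that True by (simp add: occ_Node occ_eq_0_if_size_less)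
      thus ?thesis by simp
    qed (simp add: occ_def)
    hence "bst_ex n ?Q = 0" using bst_ex_cong[of n ?Q "\<lambda>_. 0"] by (simp add: bst_ex_const)
    thus ?thesis by simp
  next
    case False
    then obtain m where n: "n = Suc m" by (cases n) auto
    define S where "S = (\<Sum>i\<le>m. bst_ex i ?Q)"
    define T where "T = (\<Sum>i\<le>m. 2 * bst_ex i (occ s) * bst_ex (m - i) (occ s))"
    have "bst_ex n ?Q = (\<Sum>i\<le>m. bst_ex i (\<lambda>l. bst_ex (m - i) (\<lambda>r. ?Q l + ?Q r + (2 * occ s l) * occ s r))) / real n"
      unfolding n bst_ex_Suc using False
      by (intro arg_cong2[of _ _ _ _ "(/)"] sum.cong bst_ex_cong refl)
         (auto simp: occ_Node n algebra_simps)
    also have "\<dots> = (\<Sum>i\<le>m. bst_ex i ?Q + bst_ex (m - i) ?Q + 2 * bst_ex i (occ s) * bst_ex (m - i) (occ s)) / real n"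
      by (simp only: bst_ex_add bst_ex_const bst_ex_cmult bst_ex_multc)
    also have "(\<Sum>i\<le>m. bst_ex i ?Q + bst_ex (m - i) ?Q + 2 * bst_ex i (occ s) * bst_ex (m - i) (occ s)) =
               2 * S + T"
      unfolding sum.distrib sum_diff_reindex[of "\<lambda>i. bst_ex i ?Q"] S_def T_def by simp
    finally have eq: "bst_ex n ?Q = (2 * S + T) / real n" .
    have "S \<le> (\<Sum>i\<le>m. 6 * wt s ^ 2 * real i ^ 2)"
      unfolding S_def using less n by (intro sum_mono) auto
    also have "\<dots> = 6 * wt s ^ 2 * (\<Sum>i\<le>m. real i ^ 2)"
      by (simp flip: sum_distrib_left)
    also have "(\<Sum>i\<le>m. real i ^ 2) \<le> real n ^ 3 / 3"
      unfolding n by (induction m) (auto simp: field_simps power2_eq_square power3_eq_cube)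
    finally have S: "S \<le> 6 * wt s ^ 2 * (real n ^ 3 / 3)" by (simp add: mult_left_mono)
    have "T \<le> (\<Sum>i\<le>m. 2 * (wt s * real n) * (wt s * real n))"
      unfolding T_def
    proof (rule sum_mono)
      fix i assume "i \<in> {..m}"
      hence i: "i \<le> n" "m - i \<le> n" using n by auto
      have *: "bst_ex j (occ s) \<le> wt s * real n" if "j \<le> n" for j
      proof -
        have "wt s * real j \<le> wt s * real n" using that by (intro mult_left_mono) simp_all
        thus ?thesis using bst_ex_occ[OF assms, of j] by linarith
      qed
      show "2 * bst_ex i (occ s) * bst_ex (m - i) (occ s) \<le> 2 * (wt s * real n) * (wt s * real n)"
      proof (rule mult_mono)
        show "2 * bst_ex i (occ s) \<le> 2 * (wt s * real n)" using *[OF i(1)] by simp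
        show "bst_ex (m - i) (occ s) \<le> wt s * real n" by (rule *[OF i(2)])
        show "0 \<le> bst_ex (m - i) (occ s)" by (intro bst_ex_nonneg occ_nonneg)
      qed simp
    qed
    also have "\<dots> = 2 * wt s ^ 2 * real n ^ 3"
      unfolding n by (simp add: power2_eq_square power3_eq_cube)
    finally have T: "T \<le> 2 * wt s ^ 2 * real n ^ 3" .
    have "2 * S + T \<le> 6 * wt s ^ 2 * real n ^ 3" using S T by (simp add: algebra_simps)
    hence "(2 * S + T) / real n \<le> 6 * wt s ^ 2 * real n ^ 3 / real n"
      by (rule divide_right_mono) simp
    also have "\<dots> = 6 * wt s ^ 2 * real n ^ 2"
      using n by (simp add: power2_eq_square power3_eq_cube)
    finally show ?thesis unfolding eq .
  qed
qed

section \<open>Typical shapes and their collisions\<close>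

definition atypical :: "real \<Rightarrow> nat \<Rightarrow> unit tree \<Rightarrow> real" where
  "atypical c m s = of_bool (size s \<ge> m \<and> wt s > exp (- c * real (size s)))"

text \<open>The cap \<open>size s \<le> n\<close> makes the set finite and loses nothing in trees of
  size \<open>n\<close>.\<close>

definition typical :: "real \<Rightarrow> nat \<Rightarrow> nat \<Rightarrow> unit tree set" where
  "typical c m n = {s. m \<le> size s \<and> size s \<le> n \<and> wt s \<le> exp (- c * real (size s))}"

text \<open>The number of ordered pairs of distinct vertices carrying the same typical
  shape.\<close>

definition collisions :: "real \<Rightarrow> nat \<Rightarrow> nat \<Rightarrow> unit tree \<Rightarrow> real" where
  "collisions c m n t = (\<Sum>s\<in>typical c m n. occ s t * (occ s t - 1))"

lemma finite_typical: "finite (typical c m n)"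
proof (rule finite_subset)
  show "typical c m n \<subseteq> {t. size t < Suc n}" by (auto simp: typical_def)
qed (rule card_size_less)

text \<open>Each vertex counted by \<open>at_least m\<close> carries a typical or an atypical shape.
  For the typical ones, \<open>occ_minus_pairs_le_1\<close> turns occurrences minus collisions into
  a lower bound for the number of shapes present.\<close>

lemma card_subtrees_lower:
  assumes "m > 0"
  shows "fringe_sum (\<lambda>s. at_least m (size s)) t - fringe_sum (atypical c m) t - collisions c m (size t) t
           \<le> real (card (subtrees t - {Leaf}))"
proof -
  let ?G = "typical c m (size t)"
  have "fringe_sum (\<lambda>s. at_least m (size s)) t
          \<le> fringe_sum (\<lambda>u. (\<Sum>s\<in>?G. of_bool (u = s)) + atypical c m u) t"
  proof (rule fringe_sum_mono)
    fix u :: "unit tree" assume "u \<noteq> Leaf" "size u \<le> size t"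
    moreover have "(\<Sum>s\<in>?G. of_bool (u = s)) = (of_bool (u \<in> ?G) :: real)"
      using sum.delta[OF finite_typical, of u "\<lambda>_. 1::real" c m "size t"]
      by (simp add: of_bool_def eq_commute)
    ultimately show "at_least m (size u) \<le> (\<Sum>s\<in>?G. of_bool (u = s)) + atypical c m u"
      by (auto simp: at_least_def atypical_def typical_def)
  qed
  also have "\<dots> = (\<Sum>s\<in>?G. occ s t) + fringe_sum (atypical c m) t"
    by (simp add: fringe_sum_add fringe_sum_sum occ_def)
  also have "(\<Sum>s\<in>?G. occ s t) = (\<Sum>s\<in>?G. occ s t - occ s t * (occ s t - 1)) + collisions c m (size t) t"
    by (simp add: collisions_def sum_subtractf)
  also have "(\<Sum>s\<in>?G. occ s t - occ s t * (occ s t - 1)) \<le> (\<Sum>s\<in>?G. of_bool (s \<in> subtrees t))"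
    using occ_minus_pairs_le_1[of _ t] by (intro sum_mono) (auto simp: occ_eq_0_if_notin)
  also have "\<dots> = real (card (?G \<inter> subtrees t))"
    using finite_typical by (simp add: of_bool_def sum.If_cases)
  also have "\<dots> \<le> real (card (subtrees t - {Leaf}))"
  proof -
    have "finite (subtrees t)" by (induction t) auto
    thus ?thesis using assms by (intro of_nat_mono card_mono) (auto simp: typical_def)
  qed
  finally show ?thesis by simp
qed

text \<open>One factor of \<open>wt s ^ 2\<close> is at most \<open>exp (- c * size s)\<close>; the
  other sums to 1 over the shapes of each size, leaving a geometric series from \<open>m\<close>
  on.\<close>

lemma bst_ex_collisions:
  assumes "c > 0" "m > 0"
  shows "bst_ex n (collisions c m n) \<le> 6 * real n ^ 2 * exp (- c * real m) / (1 - exp (- c))"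
proof -
  define G where "G = typical c m n"
  have "(\<Sum>s\<in>G. wt s ^ 2) \<le> (\<Sum>s\<in>G. wt s * exp (- c) ^ size s)"
    by (intro sum_mono)
      (auto simp: G_def typical_def power2_eq_square mult_ac simp flip: exp_of_nat_mult
            intro!: mult_left_mono)
  also have "\<dots> \<le> (\<Sum>s\<in>(\<Union>k\<in>{m..n}. shapes k). wt s * exp (- c) ^ size s)"
    by (intro sum_mono2) (auto simp: finite_shapes[unfolded shapes_def] G_def typical_def shapes_def)
  also have "\<dots> = (\<Sum>k\<in>{m..n}. \<Sum>s\<in>shapes k. wt s * exp (- c) ^ size s)"
    by (intro sum.UNION_disjoint) (auto simp: finite_shapes[unfolded shapes_def] shapes_def)
  also have "\<dots> = (\<Sum>k\<in>{m..n}. bst_ex k (\<lambda>_. 1) * exp (- c) ^ k)"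
    unfolding bst_ex_def sum_distrib_right by (intro sum.cong) (auto simp: shapes_def)
  also have "\<dots> = (\<Sum>k\<in>{m..n}. exp (- c) ^ k)" by (simp add: bst_ex_1)
  also have "\<dots> \<le> exp (- c) ^ m / (1 - exp (- c))"
    using assms by (auto simp: sum_gp intro!: divide_right_mono)
  also have "exp (- c) ^ m = exp (- c * real m)" by (simp flip: exp_of_nat_mult add: mult_ac)
  finally have G: "(\<Sum>s\<in>G. wt s ^ 2) \<le> exp (- c * real m) / (1 - exp (- c))" .
  have "bst_ex n (collisions c m n) = (\<Sum>s\<in>G. bst_ex n (\<lambda>t. occ s t * (occ s t - 1)))"
    unfolding collisions_def G_def by (rule bst_ex_sum)
  also have "\<dots> \<le> (\<Sum>s\<in>G. 6 * wt s ^ 2 * real n ^ 2)"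
    using assms by (intro sum_mono bst_ex_occ_pairs) (auto simp: G_def typical_def)
  also have "\<dots> = 6 * real n ^ 2 * (\<Sum>s\<in>G. wt s ^ 2)"
    unfolding sum_distrib_left by (intro sum.cong) simp_all
  also have "\<dots> \<le> 6 * real n ^ 2 * (exp (- c * real m) / (1 - exp (- c)))"
    by (rule mult_left_mono[OF G]) simp
  finally show ?thesis by simp
qed

text \<open>Logarithms turn the product \<open>wt\<close> into an additive functional, which after
  truncation falls under the concentration bounds.\<close>

lemma ln_wt: "fringe_sum (\<lambda>s. ln (real (size s))) t = - ln (wt t)"
  by (induction t) (auto simp: ln_mult ln_div wt_pos)

text \<open>By \<open>bst_ex_deviation\<close> a tree of size \<open>k \<ge> m\<close> is atypical
  with probability of order \<open>1 / k\<close>; \<open>bst_ex_fringe_sum_mono\<close> carries this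
  ratio over to fringe sums.\<close>

lemma bst_ex_atypical:
  assumes "bounded_toll.rate (trunc_ln M) > c" "c > 0"
  obtains B where "B > 0"
    "\<And>n m. m > 0 \<Longrightarrow> bst_ex n (fringe_sum (atypical c m)) \<le>
       B / (real m + 1) * bst_ex n (fringe_sum (\<lambda>s. at_least m (size s)))"
proof -
  let ?F = "ln (real (Suc M))"
  interpret bounded_toll "trunc_ln M" ?F by (rule bounded_toll_trunc_ln)
  define d where "d = rate - c"
  have d: "d > 0" using assms by (simp add: d_def)
  \<comment> \<open>The summand 1 secures \<open>B > 0\<close> without a look at
    \<open>?F\<close>.\<close>
  define B where "B = 13 * ?F ^ 2 / d ^ 2 + 1"
  have B: "B > 0" by (simp add: B_def add_nonneg_pos)
  have "bst_ex k (atypical c m) \<le> B / (real m + 1) * bst_ex k (\<lambda>s. at_least m (size s))" for k m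
  proof (cases "k \<ge> m")
    case False
    have "bst_ex k (atypical c m) = bst_ex k (\<lambda>_. 0)" "bst_ex k (\<lambda>s. at_least m (size s)) = bst_ex k (\<lambda>_. 0)"
      using False by (auto intro!: bst_ex_cong simp: atypical_def at_least_def)
    thus ?thesis by (simp add: bst_ex_const)
  next
    case True
    have "bst_ex k (\<lambda>s. at_least m (size s)) = bst_ex k (\<lambda>_. 1)"
      using True by (auto intro!: bst_ex_cong simp: at_least_def)
    hence eq: "bst_ex k (\<lambda>s. at_least m (size s)) = 1" by (simp add: bst_ex_const)
    have "bst_ex k (atypical c m) \<le> bst_ex k (\<lambda>t. of_bool (\<bar>centered t\<bar> \<ge> d * (real k + 1)))"
    proof (rule bst_ex_mono)
      fix t :: "unit tree" assume t: "size t = k"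
      \<comment> \<open>A large weight means a small sum of logarithms, and truncation only lowers
        it: the sum falls short of \<open>rate * (k + 1)\<close> by at least
        \<open>d * (k + 1)\<close>.\<close>
      have "\<bar>centered t\<bar> \<ge> d * (real k + 1)" if "wt t > exp (- c * real k)"
      proof -
        have "- c * real k < ln (wt t)"
          using that wt_pos by (metis exp_less_cancel_iff exp_ln)
        moreover have "fringe_sum (\<lambda>s. trunc_ln M (size s)) t \<le> fringe_sum (\<lambda>s. ln (real (size s))) t"
        proof (rule fringe_sum_mono)
          fix u :: "unit tree" assume "u \<noteq> Leaf"
          thus "trunc_ln M (size u) \<le> ln (real (size u))"
            by (cases u) (auto simp: trunc_ln_def)
        qed
        ultimately have "fringe_sum (\<lambda>s. trunc_ln M (size s)) t \<le> c * (real k + 1)"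
          using assms(2) by (simp add: ln_wt algebra_simps)
        hence "centered t \<le> - (d * (real k + 1))"
          by (simp add: centered_def t d_def algebra_simps)
        thus ?thesis by linarith
      qed
      thus "atypical c m t \<le> of_bool (\<bar>centered t\<bar> \<ge> d * (real k + 1))"
        using t by (auto simp: atypical_def)
    qed
    also have "\<dots> \<le> 13 * ?F ^ 2 * (real k + 1) / (d * (real k + 1)) ^ 2"
      using d by (intro bst_ex_deviation) auto
    also have "\<dots> = (13 * ?F ^ 2 / d ^ 2) / (real k + 1)"
      using d by (simp add: power_mult_distrib power2_eq_square divide_simps) 
    also have "\<dots> \<le> B / (real m + 1)"
      using True B by (intro frac_le) (auto simp: B_def)
    finally show ?thesis by (simp add: eq)
  qed
  hence "bst_ex n (fringe_sum (atypical c m)) \<le>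
       B / (real m + 1) * bst_ex n (fringe_sum (\<lambda>s. at_least m (size s)))" for n m
    by (intro bst_ex_fringe_sum_mono)
  thus ?thesis using that[OF B] by blast
qed

lemma bst_ex_at_least:
  assumes "m > 0"
  shows "bst_ex n (fringe_sum (\<lambda>s. at_least m (size s))) \<le> 2 * (real n + 1) / (real m + 1) + 2"
proof -
  interpret bounded_toll "at_least m" 1 using assms by (rule bounded_toll_at_least)
  have "bst_ex n (fringe_sum (\<lambda>s. at_least m (size s))) = bst_ex n (\<lambda>t. centered t + rate * (real n + 1))"
    by (rule bst_ex_cong) (simp add: centered_def)
  also have "\<dots> = mean n + 2 * (real n + 1) / (real m + 1)"
    by (simp add: bst_ex_add bst_ex_const bst_ex_centered rate_at_least assms)
  finally show ?thesis using abs_mean_le[of n] by simp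
qed

subsection \<open>Asymptotics\<close>

definition growth :: "nat \<Rightarrow> real" where
  "growth n = real n / ln (real n)"

definition distinct_fringe :: "unit tree \<Rightarrow> real" where
  "distinct_fringe t = real (card (subtrees t - {Leaf}))"

lemma growth_nonneg: "growth n \<ge> 0"
  unfolding growth_def by (cases "n = 0") auto

lemma growth_pos: "n \<ge> 2 \<Longrightarrow> growth n > 0"
  unfolding growth_def by auto

lemma distinct_fringe_nonneg: "distinct_fringe t \<ge> 0"
  by (simp add: distinct_fringe_def)

lemma centered_at_least:
  assumes "m > 0"
  shows "bounded_toll.centered (at_least m) t =
           fringe_sum (\<lambda>s. at_least m (size s)) t - 2 * (real (size t) + 1) / (real m + 1)"
proof -
  interpret bounded_toll "at_least m" 1 using assms by (rule bounded_toll_at_least)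
  show ?thesis by (simp add: centered_def rate_at_least assms)
qed

lemma bst_ex_at_least_deviation:
  assumes "m > 0" "a > 0"
  shows "bst_ex n (\<lambda>t. of_bool (\<bar>bounded_toll.centered (at_least m) t\<bar> \<ge> a)) \<le> 13 * (real n + 1) / a ^ 2"
  using bounded_toll.bst_ex_deviation[OF bounded_toll_at_least[OF assms(1)] assms(2), of n] by simp

text \<open>The ratio is of order \<open>(ln n)^2 / n\<close>.\<close>

lemma tendsto_at_least_deviation:
  assumes "\<delta> > 0"
  shows "(\<lambda>n. 13 * (real n + 1) / (\<delta> * growth n) ^ 2) \<longlonglongrightarrow> 0"
  unfolding growth_def using assms by real_asymp

lemma distinct_fringe_upper:
  "distinct_fringe t \<le> 2 * 4 ^ m + fringe_sum (\<lambda>s. at_least m (size s)) t"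
  using card_subtrees_upper[of t m] by (simp add: distinct_fringe_def at_least_def)

lemma distinct_fringe_lower:
  "m > 0 \<Longrightarrow> fringe_sum (\<lambda>s. at_least m (size s)) t - fringe_sum (atypical c m) t - collisions c m (size t) t
     \<le> distinct_fringe t"
  using card_subtrees_lower[of m t c] by (simp add: distinct_fringe_def)

lemma c6_pos: "c6 > 0"
  by (simp add: c6_def)

lemma c5_pos: "c5 > 0"
proof -
  have "(\<Sum>k. ln (real (Suc k)) / ((real (Suc k) + 1) * (real (Suc k) + 2))) > 0"
    by (rule suminf_pos2[OF summable_c5, of 1]) auto
  thus ?thesis by (simp add: c5_def)
qed

section \<open>Upper bound\<close>

lemma upper_cutoff:
  assumes "x > c6"
  obtains m \<delta> where "\<delta> > 0" "eventually (\<lambda>n. m n > 0) sequentially"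
    "eventually (\<lambda>n. 2 * 4 ^ m n + 2 * (real n + 1) / (real (m n) + 1) + \<delta> * growth n \<le> x * growth n) sequentially"
proof -
  have ln4: "ln 4 = 2 * ln (2 :: real)" using ln_realpow[of 2 2] by simp
  have x: "x > 0" using assms c6_pos by simp
  \<comment> \<open>The window for \<open>a\<close> is nonempty because
    \<open>c6 = 2 * ln 4\<close>. With \<open>m\<close> near \<open>a * ln n\<close>,
    \<open>a < 1 / ln 4\<close> makes \<open>4 ^ m\<close> at most \<open>n powr b\<close> with
    \<open>b < 1\<close>, and \<open>2 / x < a\<close> keeps \<open>2 n / m\<close> below
    \<open>x * growth n\<close>.\<close>
  have "2 / x < 1 / ln 4" using assms x by (simp add: ln4 c6_def field_simps)
  then obtain a where a: "2 / x < a" "a < 1 / ln 4" using dense by blast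
  have "0 < 2 / x" using x by simp
  hence a_pos: "a > 0" using a by linarith
  have ax: "2 / a < x" using a a_pos x by (simp add: field_simps)
  define b where "b = a * ln 4"
  have b: "b < 1" using a by (simp add: b_def field_simps)
  define m where "m = (\<lambda>n::nat. nat \<lfloor>a * ln (real n)\<rfloor>)"
  \<comment> \<open>Half of the gap; the other half keeps the comparison of limits strict.\<close>
  define \<delta> where "\<delta> = (x - 2 / a) / 2"
  have \<delta>: "\<delta> > 0" using ax by (simp add: \<delta>_def)
  have "filterlim (\<lambda>n::nat. a * ln (real n)) at_top sequentially" using a_pos by real_asymp
  hence m1: "eventually (\<lambda>n::nat. a * ln (real n) > 1) sequentially"
    by (simp add: filterlim_at_top_dense)
  have "(\<lambda>n::nat. (2 * real n powr b + 2 * (real n + 1) / (a * ln (real n))) / (real n / ln (real n))) \<longlonglongrightarrow> 2 * inverse a"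
    using a_pos b by real_asymp
  hence "(\<lambda>n::nat. (2 * real n powr b + 2 * (real n + 1) / (a * ln (real n))) / (real n / ln (real n))) \<longlonglongrightarrow> 2 / a"
    by (simp only: divide_inverse[of 2 a])
  moreover have "2 / a < x - \<delta>"
  proof -
    have "q < x \<Longrightarrow> q < x - (x - q) / 2" for q by (simp add: field_simps)
    from this[OF ax] show ?thesis unfolding \<delta>_def .
  qed
  ultimately have ev: "eventually (\<lambda>n::nat. (2 * real n powr b + 2 * (real n + 1) / (a * ln (real n))) / (real n / ln (real n)) < x - \<delta>) sequentially"
    by (rule order_tendstoD(2))
  show ?thesis
  proof (rule that[of \<delta> m])
    show "\<delta> > 0" by fact
    show "eventually (\<lambda>n. m n > 0) sequentially"
      using m1 by eventually_elim (simp add: m_def)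
    show "eventually (\<lambda>n. 2 * 4 ^ m n + 2 * (real n + 1) / (real (m n) + 1) + \<delta> * growth n \<le> x * growth n) sequentially"
      using m1 ev eventually_ge_at_top[of 2]
    proof eventually_elim
      case (elim n)
      \<comment> \<open>Rounding down bounds \<open>4 ^ m n\<close> from above, and the
        \<open>+ 1\<close> in the denominator of the rate makes up for the rounding.\<close>
      have m: "real (m n) \<le> a * ln (real n)" "a * ln (real n) < real (m n) + 1"
        using elim(1) unfolding m_def by linarith+
      have "4 ^ m n = (4 :: real) powr real (m n)" by (simp add: powr_realpow)
      also have "\<dots> \<le> 4 powr (a * ln (real n))" using m by (intro powr_mono) auto
      also have "\<dots> = real n powr b" using elim by (simp add: powr_def b_def mult_ac)
      finally have 1: "4 ^ m n \<le> real n powr b" .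
      have 2: "2 * (real n + 1) / (real (m n) + 1) \<le> 2 * (real n + 1) / (a * ln (real n))"
        using m elim by (intro divide_left_mono) auto
      have "2 * real n powr b + 2 * (real n + 1) / (a * ln (real n)) < (x - \<delta>) * growth n"
        using elim(2) growth_pos[OF elim(3)] unfolding growth_def[symmetric]
        by (simp add: pos_divide_less_eq)
      with 1 2 show ?case by (simp add: algebra_simps)
    qed
  qed
qed

lemma tendsto_prob_upper:
  assumes "x > c6"
  shows "(\<lambda>n. bst_ex n (\<lambda>t. of_bool (distinct_fringe t > x * growth n))) \<longlonglongrightarrow> 0"
proof -
  obtain m \<delta> where m: "\<delta> > 0" "eventually (\<lambda>n. m n > 0) sequentially"
    "eventually (\<lambda>n. 2 * 4 ^ m n + 2 * (real n + 1) / (real (m n) + 1) + \<delta> * growth n \<le> x * growth n) sequentially"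
    using upper_cutoff[OF assms] .
  have "eventually (\<lambda>n. bst_ex n (\<lambda>t. of_bool (distinct_fringe t > x * growth n)) 
          \<le> 13 * (real n + 1) / (\<delta> * growth n) ^ 2) sequentially"
    using m(2,3) eventually_ge_at_top[of 2]
  proof eventually_elim
    case (elim n)
    have "bst_ex n (\<lambda>t. of_bool (distinct_fringe t > x * growth n)) \<le>
            bst_ex n (\<lambda>t. of_bool (\<bar>bounded_toll.centered (at_least (m n)) t\<bar> \<ge> \<delta> * growth n))"
    proof (rule bst_ex_mono)
      fix t :: "unit tree" assume t: "size t = n"
      have "\<delta> * growth n \<le> bounded_toll.centered (at_least (m n)) t" if "distinct_fringe t > x * growth n"
        using that distinct_fringe_upper[of t "m n"] elim(2) centered_at_least[OF elim(1), of t] t by simp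
      thus "of_bool (distinct_fringe t > x * growth n) \<le>
              (of_bool (\<bar>bounded_toll.centered (at_least (m n)) t\<bar> \<ge> \<delta> * growth n) :: real)"
        by auto
    qed
    also have "\<dots> \<le> 13 * (real n + 1) / (\<delta> * growth n) ^ 2"
      using elim m(1) growth_pos[of n] by (intro bst_ex_at_least_deviation) auto
    finally show ?case .
  qed
  thus ?thesis
    by (rule tendsto_sandwich[OF always_eventually _ tendsto_const tendsto_at_least_deviation[OF m(1)], rotated])
       (auto intro!: bst_ex_nonneg)
qed

lemma eventually_ex_upper:
  assumes "x > c6"
  shows "eventually (\<lambda>n. bst_ex n distinct_fringe \<le> x * growth n) sequentially"
proof -
  obtain m \<delta> where m: "\<delta> > 0" "eventually (\<lambda>n. m n > 0) sequentially"
    "eventually (\<lambda>n. 2 * 4 ^ m n + 2 * (real n + 1) / (real (m n) + 1) + \<delta> * growth n \<le> x * growth n) sequentially"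
    using upper_cutoff[OF assms] .
  \<comment> \<open>The slack eventually covers the additive error 2 of
    \<open>bst_ex_at_least\<close>.\<close>
  have "filterlim (\<lambda>n. \<delta> * growth n) at_top sequentially"
    unfolding growth_def using m(1) by real_asymp
  hence "eventually (\<lambda>n. \<delta> * growth n > 2) sequentially"
    by (simp add: filterlim_at_top_dense)
  with m(2,3) show ?thesis
  proof eventually_elim
    case (elim n)
    have "bst_ex n distinct_fringe \<le> bst_ex n (\<lambda>t. 2 * 4 ^ m n + fringe_sum (\<lambda>s. at_least (m n) (size s)) t)"
      by (intro bst_ex_mono distinct_fringe_upper)
    also have "\<dots> = 2 * 4 ^ m n + bst_ex n (fringe_sum (\<lambda>s. at_least (m n) (size s)))"
      by (simp add: bst_ex_add bst_ex_const)
    also have "\<dots> \<le> 2 * 4 ^ m n + (2 * (real n + 1) / (real (m n) + 1) + 2)"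
      by (intro add_left_mono bst_ex_at_least elim)
    finally show ?case using elim by linarith
  qed
qed

section \<open>Lower bound\<close>

lemma tendsto_prob_lower:
  assumes "0 < x" "x < c5"
  shows "(\<lambda>n. bst_ex n (\<lambda>t. of_bool (distinct_fringe t < x * growth n))) \<longlonglongrightarrow> 0"
proof -
  \<comment> \<open>The window \<open>1 / c < a < 2 / x\<close> opens because
    \<open>x < 2 c\<close>. A cutoff near \<open>a * ln n\<close> then leaves about
    \<open>2 / a * growth n\<close> vertices, more than \<open>x * growth n\<close>, while
    \<open>b = c * a > 1\<close> makes collisions negligible.\<close>
  obtain c where c: "x / 2 < c" "c < c5 / 2" using dense[of "x / 2" "c5 / 2"] assms by auto
  have c_pos: "c > 0" using c assms by simp
  have "1 / c < 2 / x" using c c_pos assms by (simp add: field_simps)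
  then obtain a where a: "1 / c < a" "a < 2 / x" using dense by blast
  have "0 < 1 / c" using c_pos by simp
  hence a_pos: "a > 0" using a by linarith
  have ax: "x < 2 / a" using a a_pos assms by (simp add: field_simps)
  define b where "b = c * a"
  have b: "b > 1" using a c_pos by (simp add: b_def field_simps)
  have "eventually (\<lambda>M. c < bounded_toll.rate (trunc_ln M)) sequentially"
    by (rule order_tendstoD(1)[OF rate_trunc_ln_tendsto c(2)])
  then obtain M where M: "c < bounded_toll.rate (trunc_ln M)"
    using eventually_happens' sequentially_bot by blast
  obtain B where B: "B > 0" "\<And>n m. m > 0 \<Longrightarrow> bst_ex n (fringe_sum (atypical c m)) \<le>
       B / (real m + 1) * bst_ex n (fringe_sum (\<lambda>s. at_least m (size s)))"
    using bst_ex_atypical[OF M c_pos] by blast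
  define m where "m = (\<lambda>n::nat. nat \<lceil>a * ln (real n)\<rceil>)"
  \<comment> \<open>A quarter of the gap: three error terms cost \<open>\<delta> * growth n\<close>
    each, and a quarter remains for strictness.\<close>
  define \<delta> where "\<delta> = (2 / a - x) / 4"
  have \<delta>: "\<delta> > 0" using ax by (simp add: \<delta>_def)
  define K where "K = 1 - exp (- c)"
  have K: "K > 0" using c_pos by (simp add: K_def)
  \<comment> \<open>Bounds for deviation, atypical subtrees and collisions. \<open>g2\<close> is of
    order \<open>1 / ln n\<close> and \<open>g3\<close> of order
    \<open>n powr (1 - b) * ln n\<close>.\<close>
  define g1 where "g1 = (\<lambda>n. 13 * (real n + 1) / (\<delta> * growth n) ^ 2)"
  define g2 where "g2 = (\<lambda>n::nat. B / (a * ln (real n)) * (2 * (real n + 1) / (a * ln (real n)) + 2) / (\<delta> * growth n))"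
  define g3 where "g3 = (\<lambda>n::nat. 6 * real n ^ 2 * real n powr (- b) / K / (\<delta> * growth n))"
  have "g1 \<longlonglongrightarrow> 0" unfolding g1_def by (rule tendsto_at_least_deviation[OF \<delta>])
  moreover have "g2 \<longlonglongrightarrow> 0" unfolding g2_def growth_def using a_pos \<delta> B(1) by real_asymp
  moreover have "g3 \<longlonglongrightarrow> 0" unfolding g3_def growth_def using b \<delta> K by real_asymp
  ultimately have g: "(\<lambda>n. g1 n + g2 n + g3 n) \<longlonglongrightarrow> 0"
    using tendsto_add[OF tendsto_add] by fastforce
  have "filterlim (\<lambda>n::nat. a * ln (real n)) at_top sequentially" using a_pos by real_asymp
  hence m1: "eventually (\<lambda>n::nat. a * ln (real n) > 1) sequentially"
    by (simp add: filterlim_at_top_dense)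
  \<comment> \<open>Rounding up gives \<open>k + 1 \<le> a * ln n + 2\<close>, whence this
    denominator.\<close>
  have "(\<lambda>n::nat. (2 * (real n + 1) / (a * ln (real n) + 2)) / (real n / ln (real n))) \<longlonglongrightarrow> 2 * inverse a"
    using a_pos by real_asymp
  hence "(\<lambda>n::nat. (2 * (real n + 1) / (a * ln (real n) + 2)) / (real n / ln (real n))) \<longlonglongrightarrow> 2 / a"
    by (simp only: divide_inverse[of 2 a])
  moreover have "x + 3 * \<delta> < 2 / a"
  proof -
    have "x < q \<Longrightarrow> x + 3 * ((q - x) / 4) < q" for q by (simp add: field_simps)
    from this[OF ax] show ?thesis unfolding \<delta>_def .
  qed
  ultimately have ev: "eventually (\<lambda>n::nat. x + 3 * \<delta> < (2 * (real n + 1) / (a * ln (real n) + 2)) / (real n / ln (real n))) sequentially"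
    by (rule order_tendstoD(1))
  have "eventually (\<lambda>n. bst_ex n (\<lambda>t. of_bool (distinct_fringe t < x * growth n)) \<le> g1 n + g2 n + g3 n) sequentially"
    using m1 ev eventually_ge_at_top[of 2]
  proof eventually_elim
    case (elim n)
    define k where "k = m n"
    have k: "a * ln (real n) \<le> real k" "real k \<le> a * ln (real n) + 1"
      using elim(1) unfolding m_def k_def by linarith+
    have k_pos: "k > 0" using k elim(1) by (intro gr0I) auto
    define s where "s = \<delta> * growth n"
    have s: "s > 0" using \<delta> growth_pos[OF elim(3)] by (simp add: s_def)
    define X where "X = bounded_toll.centered (at_least k)"
    have "(x + 3 * \<delta>) * growth n < 2 * (real n + 1) / (a * ln (real n) + 2)"
      using elim(2) growth_pos[OF elim(3)] unfolding growth_def[symmetric]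
      by (simp only: pos_less_divide_eq)
    also have "\<dots> \<le> 2 * (real n + 1) / (real k + 1)"
      using k elim(1) by (intro divide_left_mono) auto
    finally have mean: "x * growth n + 3 * s < 2 * (real n + 1) / (real k + 1)"
      by (simp add: s_def algebra_simps)
    have "bst_ex n (\<lambda>t. of_bool (distinct_fringe t < x * growth n)) \<le>
      bst_ex n (\<lambda>t. of_bool (\<bar>X t\<bar> \<ge> s) + of_bool (fringe_sum (atypical c k) t \<ge> s)
                    + of_bool (collisions c k n t \<ge> s))"
    proof (rule bst_ex_mono)
      fix t :: "unit tree" assume t: "size t = n"
      \<comment> \<open>If all three events fail, the count of large fringe subtrees exceeds
        \<open>x * growth n + 2 * s\<close>, and the two subtracted terms are below \<open>s\<close>
        each.\<close>
      show "of_bool (distinct_fringe t < x * growth n) \<le>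
         (of_bool (\<bar>X t\<bar> \<ge> s) + of_bool (fringe_sum (atypical c k) t \<ge> s)
                    + of_bool (collisions c k n t \<ge> s) :: real)"
        using distinct_fringe_lower[OF k_pos, of t c] centered_at_least[OF k_pos, of t] mean t
        unfolding X_def[symmetric] by (auto simp: of_bool_def)
    qed
    also have "\<dots> = bst_ex n (\<lambda>t. of_bool (\<bar>X t\<bar> \<ge> s)) + bst_ex n (\<lambda>t. of_bool (fringe_sum (atypical c k) t \<ge> s))
                    + bst_ex n (\<lambda>t. of_bool (collisions c k n t \<ge> s))"
      by (simp add: bst_ex_add)
    also have "\<dots> \<le> g1 n + g2 n + g3 n"
    proof (intro add_mono)
      show "bst_ex n (\<lambda>t. of_bool (\<bar>X t\<bar> \<ge> s)) \<le> g1 n"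
        unfolding X_def g1_def s_def[symmetric] by (rule bst_ex_at_least_deviation[OF k_pos s])
      have "bst_ex n (\<lambda>t. of_bool (fringe_sum (atypical c k) t \<ge> s)) \<le> bst_ex n (fringe_sum (atypical c k)) / s"
        by (intro bst_ex_markov s fringe_sum_nonneg) (simp add: atypical_def)
      also have "\<dots> \<le> (B / (a * ln (real n)) * (2 * (real n + 1) / (a * ln (real n)) + 2)) / s"
      proof (rule divide_right_mono)
        have "bst_ex n (fringe_sum (atypical c k)) \<le> B / (real k + 1) * bst_ex n (fringe_sum (\<lambda>s. at_least k (size s)))"
          by (rule B(2)[OF k_pos])
        also have "\<dots> \<le> B / (real k + 1) * (2 * (real n + 1) / (real k + 1) + 2)"
          using B(1) by (intro mult_left_mono bst_ex_at_least k_pos) auto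
        also have "\<dots> \<le> B / (a * ln (real n)) * (2 * (real n + 1) / (a * ln (real n)) + 2)"
          using B(1) k elim(1) by (intro mult_mono add_mono divide_left_mono) auto
        finally show "bst_ex n (fringe_sum (atypical c k)) \<le> \<dots>" .
      qed (use s in simp)
      finally show "bst_ex n (\<lambda>t. of_bool (fringe_sum (atypical c k) t \<ge> s)) \<le> g2 n"
        by (simp add: g2_def s_def)
      have "bst_ex n (\<lambda>t. of_bool (collisions c k n t \<ge> s)) \<le> bst_ex n (collisions c k n) / s"
        by (intro bst_ex_markov s) (auto simp: collisions_def occ_pairs_nonneg intro!: sum_nonneg)
      also have "\<dots> \<le> (6 * real n ^ 2 * exp (- c * real k) / K) / s"
        using bst_ex_collisions[OF c_pos k_pos, of n] s unfolding K_def by (intro divide_right_mono) auto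
      also have "\<dots> \<le> (6 * real n ^ 2 * real n powr (- b) / K) / s"
      proof -
        have "c * (a * ln (real n)) \<le> c * real k" using k c_pos by (intro mult_left_mono) auto
        hence "exp (- c * real k) \<le> real n powr (- b)"
          using elim(3) by (simp add: powr_def b_def mult_ac)
        thus ?thesis using s K by (intro divide_right_mono mult_left_mono) auto
      qed
      finally show "bst_ex n (\<lambda>t. of_bool (collisions c k n t \<ge> s)) \<le> g3 n"
        by (simp add: g3_def s_def)
    qed
    finally show ?case .
  qed
  thus ?thesis
    by (rule tendsto_sandwich[OF always_eventually _ tendsto_const g, rotated])
       (auto intro!: bst_ex_nonneg)
qed

text \<open>The count is nonnegative, so its mean is at least \<open>y * growth n\<close> times the
  probability of reaching that level, which eventually exceeds \<open>x / y\<close>.\<close>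

lemma eventually_ex_lower:
  assumes "0 < x" "x < c5"
  shows "eventually (\<lambda>n. x * growth n \<le> bst_ex n distinct_fringe) sequentially"
proof -
  obtain y where y: "x < y" "y < c5" using dense[OF assms(2)] by blast
  have "y > 0" using y assms by simp
  have "1 - x / y > 0" using y assms by simp
  from order_tendstoD(2)[OF tendsto_prob_lower[OF \<open>y > 0\<close> y(2)] this] show ?thesis
  proof eventually_elim
    case (elim n)
    define p where "p = bst_ex n (\<lambda>t. of_bool (distinct_fringe t < y * growth n))"
    have "x * growth n = y * growth n * (x / y)" using \<open>y > 0\<close> by simp
    also have "\<dots> \<le> y * growth n * (1 - p)"
      using elim \<open>y > 0\<close> growth_nonneg[of n] unfolding p_def by (intro mult_left_mono) auto
    also have "\<dots> = bst_ex n (\<lambda>t. y * growth n + (- (y * growth n)) * of_bool (distinct_fringe t < y * growth n))"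
      by (simp only: bst_ex_add bst_ex_cmult bst_ex_const p_def) (simp add: algebra_simps)
    also have "\<dots> \<le> bst_ex n distinct_fringe"
      by (rule bst_ex_mono) (auto simp: of_bool_def distinct_fringe_nonneg)
    finally show ?case .
  qed
qed

text \<open>Choose \<open>\<epsilon> n\<close> just above the Ky Fan distance \<open>Inf {e > 0. P e n \<le> e}\<close>.\<close>
lemma ky_fan:
  fixes P :: "real \<Rightarrow> nat \<Rightarrow> real"
  assumes lim: "\<And>e. 0 < e \<Longrightarrow> e < 1 \<Longrightarrow> P e \<longlonglongrightarrow> 0"
    and mono: "\<And>e e' n. e \<le> e' \<Longrightarrow> P e' n \<le> P e n"
    and bounds: "\<And>e n. P e n \<ge> 0" "\<And>e n. P e n \<le> 1"
  obtains \<epsilon> where "\<epsilon> \<longlonglongrightarrow> 0" "(\<lambda>n. P (\<epsilon> n) n) \<longlonglongrightarrow> 0"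
proof -
  define A where "A = (\<lambda>n. {e. e > 0 \<and> P e n \<le> e})"
  define d where "d = (\<lambda>n. Inf (A n))"
  have ne: "A n \<noteq> {}" for n using bounds(2)[of 1 n] by (auto simp: A_def intro!: exI[of _ 1])
  have bdd: "bdd_below (A n)" for n by (rule bdd_belowI[of _ 0]) (auto simp: A_def)
  have d_nonneg: "d n \<ge> 0" for n
    unfolding d_def by (rule cInf_greatest[OF ne]) (auto simp: A_def)
  have d_lim: "d \<longlonglongrightarrow> 0"
  proof (rule tendstoI)
    fix r :: real assume r: "r > 0"
    \<comment> \<open>The limit is assumed only for tolerances below 1, hence the minimum.\<close>
    define e where "e = min r 1 / 2"
    have e: "e > 0" "e < 1" "e < r" using r by (auto simp: e_def min_def)
    have "eventually (\<lambda>n. P e n < e) sequentially"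
      by (rule order_tendstoD(2)[OF lim[OF e(1,2)] e(1)])
    thus "eventually (\<lambda>n. dist (d n) 0 < r) sequentially"
    proof eventually_elim
      case (elim n)
      have "d n \<le> e" unfolding d_def using elim e(1) by (intro cInf_lower bdd) (auto simp: A_def)
      thus ?case using e d_nonneg[of n] by (simp add: dist_real_def)
    qed
  qed
  define \<epsilon> where "\<epsilon> = (\<lambda>n. d n + 1 / real (Suc n))"
  have \<epsilon>: "\<epsilon> \<longlonglongrightarrow> 0"
    unfolding \<epsilon>_def using tendsto_add[OF d_lim LIMSEQ_inverse_real_of_nat] by (simp add: field_simps)
  have "P (\<epsilon> n) n \<le> \<epsilon> n" for n
  proof -
    have "Inf (A n) < \<epsilon> n" by (simp add: \<epsilon>_def d_def)
    then obtain e where "e \<in> A n" "e < \<epsilon> n" using cInf_lessD[OF ne] by blast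
    thus ?thesis using mono[of e "\<epsilon> n" n] by (auto simp: A_def)
  qed
  hence "(\<lambda>n. P (\<epsilon> n) n) \<longlonglongrightarrow> 0"
    by (auto intro!: tendsto_sandwich[OF _ _ tendsto_const \<epsilon>] simp: bounds)
  with \<epsilon> show ?thesis by (rule that)
qed

section \<open>Bounds with vanishing relative errors\<close>

lemma expectation_num_distinct_fringe:
  "measure_pmf.expectation (random_bst n) (\<lambda>t. real (num_distinct_fringe t)) = bst_ex n distinct_fringe"
  unfolding num_distinct_fringe_shape expectation_random_bst[symmetric] distinct_fringe_def ..

theorem theorem5:
  shows
    "(\<exists>\<epsilon> \<delta> :: nat \<Rightarrow> real. \<epsilon> \<longlonglongrightarrow> 0 \<and> \<delta> \<longlonglongrightarrow> 0 \<and>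
        (\<forall>n\<ge>2.
           c5 * (real n / ln (real n)) * (1 + \<epsilon> n)
             \<le> measure_pmf.expectation (random_bst n) (\<lambda>t. real (num_distinct_fringe t)) \<and>
           measure_pmf.expectation (random_bst n) (\<lambda>t. real (num_distinct_fringe t))
             \<le> c6 * (real n / ln (real n)) * (1 + \<delta> n)))
     \<and>
     (\<exists>\<epsilon> \<delta> :: nat \<Rightarrow> real. \<epsilon> \<longlonglongrightarrow> 0 \<and> \<delta> \<longlonglongrightarrow> 0 \<and>
        (\<lambda>n. measure_pmf.prob (random_bst n)
           {t. c5 * (real n / ln (real n)) * (1 + \<epsilon> n) \<le> real (num_distinct_fringe t) \<and>
               real (num_distinct_fringe t) \<le> c6 * (real n / ln (real n)) * (1 + \<delta> n)})
          \<longlonglongrightarrow> 1)"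
  unfolding growth_def[symmetric] expectation_num_distinct_fringe
proof (rule conjI)
  define u where "u = (\<lambda>n. bst_ex n distinct_fringe)"
  \<comment> \<open>Relative errors of the expectation, clipped at 0: the inequalities hold for all
    \<open>n \<ge> 2\<close> by construction, and the eventual bounds at fixed tolerance force both
    sequences to 0.\<close>
  define \<epsilon> where "\<epsilon> = (\<lambda>n. min 0 (u n / (c5 * growth n) - 1))"
  define \<delta> where "\<delta> = (\<lambda>n. max 0 (u n / (c6 * growth n) - 1))"
  have "\<epsilon> \<longlonglongrightarrow> 0"
  proof (rule tendstoI)
    fix r :: real assume r: "r > 0"
    define e where "e = min r 1 / 2"
    have e: "e > 0" "e < 1" "e < r" using r by (auto simp: e_def min_def)
    have "eventually (\<lambda>n. (c5 * (1 - e)) * growth n \<le> u n) sequentially"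
      unfolding u_def using e c5_pos by (intro eventually_ex_lower) auto
    with eventually_ge_at_top[of 2] show "eventually (\<lambda>n. dist (\<epsilon> n) 0 < r) sequentially"
    proof eventually_elim
      case (elim n)
      have "1 - e \<le> u n / (c5 * growth n)"
        using elim growth_pos[of n] c5_pos by (simp add: field_simps)
      thus ?case using e by (auto simp: \<epsilon>_def dist_real_def min_def)
    qed
  qed
  moreover have "\<delta> \<longlonglongrightarrow> 0"
  proof (rule tendstoI)
    fix r :: real assume r: "r > 0"
    have "eventually (\<lambda>n. u n \<le> (c6 * (1 + r / 2)) * growth n) sequentially"
      unfolding u_def using r c6_pos by (intro eventually_ex_upper) auto
    with eventually_ge_at_top[of 2] show "eventually (\<lambda>n. dist (\<delta> n) 0 < r) sequentially"
    proof eventually_elim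
      case (elim n)
      have "u n / (c6 * growth n) \<le> 1 + r / 2"
        using elim growth_pos[of n] c6_pos by (simp add: field_simps)
      thus ?case using r by (auto simp: \<delta>_def dist_real_def max_def)
    qed
  qed
  moreover have "c5 * growth n * (1 + \<epsilon> n) \<le> u n \<and> u n \<le> c6 * growth n * (1 + \<delta> n)" if "n \<ge> 2" for n
  proof -
    have pos: "c5 * growth n > 0" "c6 * growth n > 0"
      using growth_pos[OF that] c5_pos c6_pos by auto
    have "1 + \<epsilon> n \<le> u n / (c5 * growth n)" "u n / (c6 * growth n) \<le> 1 + \<delta> n"
      by (auto simp: \<epsilon>_def \<delta>_def)
    thus ?thesis using pos by (simp only: pos_le_divide_eq pos_divide_le_eq mult.commute)
  qed
  ultimately show "\<exists>\<epsilon> \<delta>. \<epsilon> \<longlonglongrightarrow> 0 \<and> \<delta> \<longlonglongrightarrow> 0 \<and> (\<forall>n\<ge>2.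
      c5 * growth n * (1 + \<epsilon> n) \<le> bst_ex n distinct_fringe \<and>
      bst_ex n distinct_fringe \<le> c6 * growth n * (1 + \<delta> n))"
    unfolding u_def by blast
next
  \<comment> \<open>Failure probabilities at fixed tolerance \<open>e\<close>, nonincreasing in
    \<open>e\<close> as \<open>ky_fan\<close> requires. The sequence found for \<open>P\<close>
    enters the result negated.\<close>
  define P where "P = (\<lambda>e n. bst_ex n (\<lambda>t. of_bool (distinct_fringe t < (c5 * (1 - e)) * growth n)))"
  define Q where "Q = (\<lambda>e n. bst_ex n (\<lambda>t. of_bool (distinct_fringe t > (c6 * (1 + e)) * growth n)))"
  have prob_bounds: "0 \<le> bst_ex n (\<lambda>t. of_bool (R t))" "bst_ex n (\<lambda>t. of_bool (R t)) \<le> 1" for n R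
    using bst_ex_mono[of n "\<lambda>t. of_bool (R t)" "\<lambda>_. 1"] by (auto intro!: bst_ex_nonneg simp: bst_ex_const)
  have mono5: "c5 * (1 - e') * growth n \<le> c5 * (1 - e) * growth n" 
   and mono6: "c6 * (1 + e) * growth n \<le> c6 * (1 + e') * growth n" if "e \<le> e'" for e e' n
    using that c5_pos c6_pos growth_nonneg[of n] by (auto intro!: mult_right_mono mult_left_mono)
  obtain \<epsilon> where \<epsilon>: "\<epsilon> \<longlonglongrightarrow> 0" "(\<lambda>n. P (\<epsilon> n) n) \<longlonglongrightarrow> 0"
  proof (rule ky_fan[of P])
    show "P e \<longlonglongrightarrow> 0" if "0 < e" "e < 1" for e
      unfolding P_def using that c5_pos by (intro tendsto_prob_lower) auto
    show "P e' n \<le> P e n" if "e \<le> e'" for e e' n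
      unfolding P_def using mono5[OF that, of n] by (intro bst_ex_mono) auto
  qed (auto simp: P_def prob_bounds)
  obtain \<delta> where \<delta>: "\<delta> \<longlonglongrightarrow> 0" "(\<lambda>n. Q (\<delta> n) n) \<longlonglongrightarrow> 0"
  proof (rule ky_fan[of Q])
    show "Q e \<longlonglongrightarrow> 0" if "0 < e" "e < 1" for e
      unfolding Q_def using that c6_pos by (intro tendsto_prob_upper) auto
    show "Q e' n \<le> Q e n" if "e \<le> e'" for e e' n
      unfolding Q_def using mono6[OF that, of n] by (intro bst_ex_mono) auto
  qed (auto simp: Q_def prob_bounds)
  define G where "G = (\<lambda>n t. c5 * growth n * (1 + - \<epsilon> n) \<le> distinct_fringe t \<and>
                             distinct_fringe t \<le> c6 * growth n * (1 + \<delta> n))"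
  have prob: "measure_pmf.prob (random_bst n)
           {t. c5 * growth n * (1 + - \<epsilon> n) \<le> real (num_distinct_fringe t) \<and>
               real (num_distinct_fringe t) \<le> c6 * growth n * (1 + \<delta> n)} = bst_ex n (\<lambda>t. of_bool (G n t))" for n
    unfolding prob_random_bst[symmetric] G_def distinct_fringe_def num_distinct_fringe_shape ..
  have "1 - (P (\<epsilon> n) n + Q (\<delta> n) n) \<le> bst_ex n (\<lambda>t. of_bool (G n t))" for n
  proof -
    \<comment> \<open>A union bound: every tree satisfies \<open>G n\<close> or fails on one of the
      two sides.\<close>
    have "bst_ex n (\<lambda>_. 1) \<le> bst_ex n (\<lambda>t. of_bool (G n t) +
            (of_bool (distinct_fringe t < (c5 * (1 - \<epsilon> n)) * growth n) +
             of_bool (distinct_fringe t > (c6 * (1 + \<delta> n)) * growth n)))"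
      by (rule bst_ex_mono) (auto simp: G_def of_bool_def mult_ac not_less)
    thus ?thesis by (simp add: bst_ex_add bst_ex_1 P_def Q_def)
  qed
  moreover have "(\<lambda>n. 1 - (P (\<epsilon> n) n + Q (\<delta> n) n)) \<longlonglongrightarrow> 1"
    using tendsto_diff[OF tendsto_const[of 1] tendsto_add[OF \<epsilon>(2) \<delta>(2)]] by simp
  ultimately have "(\<lambda>n. bst_ex n (\<lambda>t. of_bool (G n t))) \<longlonglongrightarrow> 1"
    using tendsto_sandwich[of "\<lambda>n. 1 - (P (\<epsilon> n) n + Q (\<delta> n) n)"
            "\<lambda>n. bst_ex n (\<lambda>t. of_bool (G n t))" sequentially "\<lambda>_. 1" 1]
    by (simp add: prob_bounds)
  moreover have "(\<lambda>n. - \<epsilon> n) \<longlonglongrightarrow> 0" using tendsto_minus[OF \<epsilon>(1)] by simp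
  ultimately show "\<exists>\<epsilon> \<delta>. \<epsilon> \<longlonglongrightarrow> 0 \<and> \<delta> \<longlonglongrightarrow> 0 \<and>
        (\<lambda>n. measure_pmf.prob (random_bst n)
           {t. c5 * growth n * (1 + \<epsilon> n) \<le> real (num_distinct_fringe t) \<and>
               real (num_distinct_fringe t) \<le> c6 * growth n * (1 + \<delta> n)}) \<longlonglongrightarrow> 1"
    using \<delta>(1) unfolding prob[symmetric] by blast
qed

end
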